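(* Let $R$ be a ring with a left Artinian left quotient ring $Q$, and let $I$ be a $\mathcal{C}$-closed ideal of $R$ such that $I\subseteq\mathfrak{n}$. Then 1. The set $\mathcal{C}_{R/I}$ of regular elements of the ring $R/I$ is equal to the set $\{c+I\mid c\in\mathcal{C}\}$. 2. The ring $R/I$ has a left Artinian left quotient ring $Q(R/I)$, $\mathcal{C}^{-1}I$ is an ideal of $Q$, and the map $Q/\mathcal{C}^{-1}I\to Q(R/I)$, $c^{-1}r+\mathcal{C}^{-1}I\mapsto (c+I)^{-1}(r+I)$, is a ring isomorphism with inverse $(c+I)^{-1}(r+I)\mapsto c^{-1}r+\mathcal{C}^{-1}I$.
   Context: Rings have $1$. For a ring $R$: $\mathcal{C}$ is the set of regular elements (non-zero-divisors) of $R$; the left quotient ring of $R$ is $Q=Q(R)=\mathcal{C}^{-1}R$ (it exists iff $\mathcal{C}$ is a left Ore set); $\mathfrak{n}$ is the prime radical of $R$. A (left) ideal $I$ of $R$ is $\mathcal{C}$-closed if, for elements $c\in\mathcal{C}$ and $r\in R$, $cr\in I$ implies $r\in I$. Ideal means two-sided ideal. *)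

theory Defs
  imports "HOL-Algebra.QuotRing" "HOL-Algebra.Ideal_Product"
begin

text \<open>
  Rings are unital and not necessarily commutative; the zero ring is allowed.
\<close>

definition regular_elements :: "('a, 'm) ring_scheme \<Rightarrow> 'a set" where
  "regular_elements R = {c \<in> carrier R. \<forall>r \<in> carrier R.
     (c \<otimes>\<^bsub>R\<^esub> r = \<zero>\<^bsub>R\<^esub> \<longrightarrow> r = \<zero>\<^bsub>R\<^esub>) \<and> (r \<otimes>\<^bsub>R\<^esub> c = \<zero>\<^bsub>R\<^esub> \<longrightarrow> r = \<zero>\<^bsub>R\<^esub>)}"

definition left_ideal :: "'a set \<Rightarrow> ('a, 'm) ring_scheme \<Rightarrow> bool" where
  "left_ideal I R \<longleftrightarrow>
     additive_subgroup I R \<and> (\<forall>a \<in> I. \<forall>x \<in> carrier R. x \<otimes>\<^bsub>R\<^esub> a \<in> I)"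

definition left_artinian :: "('a, 'm) ring_scheme \<Rightarrow> bool" where
  "left_artinian R \<longleftrightarrow>
     (\<forall>J :: nat \<Rightarrow> 'a set. (\<forall>n. left_ideal (J n) R) \<and> (\<forall>n. J (Suc n) \<subseteq> J n)
        \<longrightarrow> (\<exists>N. \<forall>n \<ge> N. J n = J N))"

text \<open>
  The locale \<open>primeideal\<close> of the library is restricted to commutative rings and
  uses elementwise (complete) primeness; here primeness is taken with respect to products of
  two-sided ideals.
\<close>

definition prime_ideal :: "'a set \<Rightarrow> ('a, 'm) ring_scheme \<Rightarrow> bool" where
  "prime_ideal P R \<longleftrightarrow> ideal P R \<and> P \<noteq> carrier R \<and>
     (\<forall>A B. ideal A R \<and> ideal B R \<and> A \<cdot>\<^bsub>R\<^esub> B \<subseteq> P \<longrightarrow> A \<subseteq> P \<or> B \<subseteq> P)"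

text \<open>
  The intersection with the carrier only matters for the zero ring, which has no prime ideals.
\<close>

definition prime_radical :: "('a, 'm) ring_scheme \<Rightarrow> 'a set" where
  "prime_radical R = carrier R \<inter> \<Inter>{P. prime_ideal P R}"

definition C_closed :: "('a, 'm) ring_scheme \<Rightarrow> 'a set \<Rightarrow> bool" where
  "C_closed R I \<longleftrightarrow>
     (\<forall>c \<in> regular_elements R. \<forall>r \<in> carrier R. c \<otimes>\<^bsub>R\<^esub> r \<in> I \<longrightarrow> r \<in> I)"

text \<open>
  The left fraction \<open>c\<inverse>r\<close>, formed in \<open>Q\<close> along the structure map \<open>\<phi>\<close> from \<open>R\<close> to \<open>Q\<close>.
\<close>

definition left_fraction ::
    "('q, 'n) ring_scheme \<Rightarrow> ('a \<Rightarrow> 'q) \<Rightarrow> 'a \<Rightarrow> 'a \<Rightarrow> 'q" where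
  "left_fraction Q \<phi> c r = inv\<^bsub>Q\<^esub> (\<phi> c) \<otimes>\<^bsub>Q\<^esub> \<phi> r"

definition left_fractions ::
    "('q, 'n) ring_scheme \<Rightarrow> ('a \<Rightarrow> 'q) \<Rightarrow> 'a set \<Rightarrow> 'a set \<Rightarrow> 'q set" where
  "left_fractions Q \<phi> C X = {left_fraction Q \<phi> c x | c x. c \<in> C \<and> x \<in> X}"

text \<open>
  \<open>(Q, \<phi>)\<close> is a left quotient ring of \<open>R\<close>, i.e. a left ring of fractions of \<open>R\<close> with respect
  to its regular elements. Such a pair is unique up to a unique isomorphism over \<open>R\<close>, and one
  exists iff the regular elements form a left Ore set. A homomorphism defining a left ring of
  fractions must have kernel \<open>{r. \<exists>c. c r = 0}\<close>, with \<open>c\<close> ranging over the denominators; as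
  these are regular here, that amounts to injectivity.
\<close>

definition left_quotient_ring ::
    "('a, 'm) ring_scheme \<Rightarrow> ('q, 'n) ring_scheme \<Rightarrow> ('a \<Rightarrow> 'q) \<Rightarrow> bool" where
  "left_quotient_ring R Q \<phi> \<longleftrightarrow>
     ring Q \<and> \<phi> \<in> ring_hom R Q \<and> inj_on \<phi> (carrier R) \<and>
     \<phi> ` regular_elements R \<subseteq> Units Q \<and>
     carrier Q = left_fractions Q \<phi> (regular_elements R) (carrier R)"

end

theory Submission
  imports Defs
begin

text \<open>
  Let \<open>L = \<C>\<inverse>I\<close>. For \<open>c \<in> \<C>\<close> the left ideals \<open>L c\<^sup>n\<close> of \<open>Q\<close> form a descending chain, and
  as \<open>c\<close> is a unit of \<open>Q\<close> its stabilisation gives \<open>L c = L\<close>; hence \<open>L\<close> is two-sided. The same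
  argument applied to arbitrary ideals of \<open>R\<close> shows that primes of \<open>Q\<close> contract to primes of \<open>R\<close>, so
  \<open>I \<subseteq> prime_radical R\<close> forces \<open>L\<close> into the prime radical of \<open>Q\<close>, whose elements \<open>l\<close> have \<open>1 - l\<close> left
  invertible. If \<open>c + I\<close> is regular, right multiplication by \<open>c\<close> is injective on the left Artinian
  ring \<open>Q/L\<close>, so \<open>c\<close> is a unit modulo \<open>L\<close>, hence a unit of \<open>Q\<close>, hence regular in \<open>R\<close>.
  The isomorphism comes from the universal property of \<open>Q\<close> applied to \<open>r \<mapsto> \<psi> (r + I)\<close>.
\<close>

subsection \<open>Left ideals and left Artinian rings\<close>

context ring
begin

lemma minus_zero_imp_eq:
  assumes "x \<in> carrier R" "y \<in> carrier R" "x \<ominus> y = \<zero>"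
  shows "x = y"
proof -
  have "x = (x \<ominus> y) \<oplus> y"
    using assms(1,2) by (simp add: a_minus_def a_assoc l_neg)
  then show ?thesis
    using assms by simp
qed

text \<open>Negation is multiplication by \<open>\<ominus> \<one>\<close>, so closure under additive
  inverses comes from absorption on the left.\<close>

lemma left_idealI:
  assumes "J \<subseteq> carrier R" "\<zero> \<in> J" "\<And>x y. x \<in> J \<Longrightarrow> y \<in> J \<Longrightarrow> x \<oplus> y \<in> J"
    and mult: "\<And>x a. x \<in> carrier R \<Longrightarrow> a \<in> J \<Longrightarrow> x \<otimes> a \<in> J"
  shows "left_ideal J R"
proof -
  have "\<ominus> a \<in> J" if "a \<in> J" for a
    using mult[of "\<ominus> \<one>" a] that assms(1) by (auto simp: l_minus)
  then show ?thesis
    unfolding left_ideal_def using assms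
    by (auto intro!: additive_subgroup.intro add.subgroupI)
qed

lemma left_ideal_closed:
  assumes "left_ideal J R"
  shows "J \<subseteq> carrier R" "\<zero> \<in> J" "x \<in> J \<Longrightarrow> y \<in> J \<Longrightarrow> x \<oplus> y \<in> J"
    and "a \<in> carrier R \<Longrightarrow> x \<in> J \<Longrightarrow> a \<otimes> x \<in> J" "x \<in> J \<Longrightarrow> y \<in> J \<Longrightarrow> x \<ominus> y \<in> J"
proof -
  interpret additive_subgroup J R
    using assms by (simp add: left_ideal_def)
  show J: "J \<subseteq> carrier R" and "\<zero> \<in> J"
    and add: "\<And>x y. x \<in> J \<Longrightarrow> y \<in> J \<Longrightarrow> x \<oplus> y \<in> J"
    by (auto intro: a_subset[THEN subsetD])
  show mult: "\<And>a x. a \<in> carrier R \<Longrightarrow> x \<in> J \<Longrightarrow> a \<otimes> x \<in> J"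
    using assms by (simp add: left_ideal_def)
  show "x \<ominus> y \<in> J" if "x \<in> J" "y \<in> J"
    using add[OF that(1) mult[of "\<ominus> \<one>" y]] that J by (auto simp: l_minus a_minus_def)
qed

lemma left_ideal_mult_right:
  assumes "left_ideal J R" "u \<in> carrier R"
  shows "left_ideal ((\<lambda>x. x \<otimes> u) ` J) R"
proof (rule left_idealI)
  note J = left_ideal_closed[OF assms(1)]
  show "(\<lambda>x. x \<otimes> u) ` J \<subseteq> carrier R"
    using J(1) assms(2) by auto
  show "\<zero> \<in> (\<lambda>x. x \<otimes> u) ` J"
    using J(2) assms(2) by (force simp: image_iff)
  show "x \<oplus> y \<in> (\<lambda>x. x \<otimes> u) ` J" if "x \<in> (\<lambda>x. x \<otimes> u) ` J" "y \<in> (\<lambda>x. x \<otimes> u) ` J" for x y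
  proof -
    obtain a where "a \<in> J" "x = a \<otimes> u"
      using \<open>x \<in> _\<close> by blast
    moreover obtain b where "b \<in> J" "y = b \<otimes> u"
      using \<open>y \<in> _\<close> by blast
    ultimately have "x \<oplus> y = (a \<oplus> b) \<otimes> u" "a \<oplus> b \<in> J"
      using J(1,3) assms(2) by (auto simp: l_distr subset_iff)
    then show ?thesis by blast
  qed
  show "a \<otimes> x \<in> (\<lambda>x. x \<otimes> u) ` J" if a: "a \<in> carrier R" and x: "x \<in> (\<lambda>x. x \<otimes> u) ` J" for a x
  proof -
    obtain b where "b \<in> J" "x = b \<otimes> u"
      using x by auto
    then have "a \<otimes> x = (a \<otimes> b) \<otimes> u" "a \<otimes> b \<in> J"
      using J(1,4) assms(2) a by (auto simp: m_assoc subset_iff)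
    then show ?thesis by blast
  qed
qed

text \<open>Since \<open>J u\<close> lies in \<open>J\<close>, the left ideals \<open>J u^n\<close>
  descend, and the equality of two successive terms is recorded elementwise. Nothing is cancelled
  yet, so that the result serves both units and elements that are merely cancellable on the
  right.\<close>

lemma left_artinian_power_stable:
  assumes art: "left_artinian R" and J: "left_ideal J R" and u: "u \<in> carrier R"
    and Ju: "\<And>x. x \<in> J \<Longrightarrow> x \<otimes> u \<in> J"
  obtains n :: nat where "\<And>x. x \<in> J \<Longrightarrow> \<exists>y \<in> J. x \<otimes> u [^] n = (y \<otimes> u) \<otimes> u [^] n"
proof -
  define K where "K = (\<lambda>n :: nat. (\<lambda>x. x \<otimes> u [^] n) ` J)"
  have carr: "x \<in> carrier R" if "x \<in> J" for x
    using left_ideal_closed(1)[OF J] that by auto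
  \<comment> \<open>The extra factor is split off on the left of the power, next to
    \<open>x\<close>, so that \<open>Ju\<close> can absorb it.\<close>
  have Suc: "x \<otimes> u [^] Suc n = (x \<otimes> u) \<otimes> u [^] n" if "x \<in> J" for x and n :: nat
    using carr[OF that] u by (simp only: nat_pow_Suc2 m_assoc nat_pow_closed)
  have "left_ideal (K n) R" for n
    unfolding K_def using left_ideal_mult_right[OF J] u by simp
  moreover have "K (Suc n) \<subseteq> K n" for n
  proof
    fix z assume "z \<in> K (Suc n)"
    then obtain x where "x \<in> J" "z = x \<otimes> u [^] Suc n"
      unfolding K_def by blast
    then show "z \<in> K n"
      unfolding K_def using Suc Ju by blast
  qed
  ultimately obtain n where "\<forall>m \<ge> n. K m = K n"
    using art unfolding left_artinian_def by blast
  then have "K (Suc n) = K n"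
    using le_SucI by blast
  have "\<exists>y \<in> J. x \<otimes> u [^] n = (y \<otimes> u) \<otimes> u [^] n" if "x \<in> J" for x
  proof -
    have "x \<otimes> u [^] n \<in> K (Suc n)"
      unfolding \<open>K (Suc n) = K n\<close> using that by (simp add: K_def)
    then obtain y where "y \<in> J" "x \<otimes> u [^] n = y \<otimes> u [^] Suc n"
      unfolding K_def by blast
    then show ?thesis
      using Suc by metis
  qed
  then show ?thesis
    using that by blast
qed

text \<open>Stabilisation of the chain \<open>R u^n\<close> gives \<open>u^n = y u u^n\<close> for
  some \<open>y\<close>. Cancelling \<open>u^n\<close> yields \<open>y u = 1\<close>, and then
  \<open>(1 - u y) u = 0\<close> yields \<open>u y = 1\<close> by one more cancellation.\<close>

lemma left_artinian_right_cancel_Units: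
  assumes art: "left_artinian R" and u: "u \<in> carrier R"
    and cancel: "\<And>x. x \<in> carrier R \<Longrightarrow> x \<otimes> u = \<zero> \<Longrightarrow> x = \<zero>"
  shows "u \<in> Units R"
proof -
  have pow: "x = \<zero>" if "x \<in> carrier R" "x \<otimes> u [^] n = \<zero>" for x and n :: nat
    using that
  proof (induction n)
    case (Suc n)
    have "(x \<otimes> u [^] n) \<otimes> u = \<zero>"
      using Suc.prems u by (simp add: m_assoc)
    then show ?case
      using Suc cancel[of "x \<otimes> u [^] n"] u by simp
  qed simp
  have "left_ideal (carrier R) R"
    by (rule left_idealI) auto
  then obtain n :: nat where
    "\<And>x. x \<in> carrier R \<Longrightarrow> \<exists>y \<in> carrier R. x \<otimes> u [^] n = (y \<otimes> u) \<otimes> u [^] n"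
    using left_artinian_power_stable[OF art _ u] u by blast
  then obtain y where y: "y \<in> carrier R" and "\<one> \<otimes> u [^] n = (y \<otimes> u) \<otimes> u [^] n"
    by blast
  then have "(\<one> \<ominus> y \<otimes> u) \<otimes> u [^] n = \<zero>"
    using u by (simp add: a_minus_def l_distr l_minus r_neg)
  then have "\<one> \<ominus> y \<otimes> u = \<zero>"
    using pow[of "\<one> \<ominus> y \<otimes> u" n] y u by simp
  then have yu: "y \<otimes> u = \<one>"
    using y u by (metis minus_zero_imp_eq m_closed one_closed)
  have "(\<one> \<ominus> u \<otimes> y) \<otimes> u = \<zero>"
    using y u yu by (simp add: a_minus_def l_distr l_minus r_neg m_assoc)
  then have "\<one> \<ominus> u \<otimes> y = \<zero>"
    using cancel[of "\<one> \<ominus> u \<otimes> y"] y u by simp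
  then have "u \<otimes> y = \<one>"
    using y u by (metis minus_zero_imp_eq m_closed one_closed)
  with yu y u show ?thesis
    by (auto simp: Units_def)
qed

text \<open>If \<open>x v = 0\<close> then \<open>x = x v c = 0\<close>, so \<open>v\<close> is
  right cancellable and therefore a unit; \<open>c\<close> has to be its inverse.\<close>

lemma left_artinian_left_inverse_Units:
  assumes art: "left_artinian R" and carr: "v \<in> carrier R" "c \<in> carrier R" and vc: "v \<otimes> c = \<one>"
  shows "c \<in> Units R"
proof -
  have "x = \<zero>" if "x \<in> carrier R" "x \<otimes> v = \<zero>" for x
  proof -
    have "x = (x \<otimes> v) \<otimes> c"
      using carr that(1) vc by (simp add: m_assoc)
    then show ?thesis
      using that carr by simp
  qed
  then have v: "v \<in> Units R"
    using left_artinian_right_cancel_Units[OF art carr(1)] by blast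
  have "c = (inv v \<otimes> v) \<otimes> c"
    using v carr by simp
  also have "\<dots> = inv v"
    using v carr vc by (simp only: m_assoc Units_inv_closed r_one)
  finally show ?thesis
    using v by simp
qed

lemma Units_r_cancel:
  assumes "u \<in> Units R" "x \<in> carrier R" "y \<in> carrier R" "x \<otimes> u = y \<otimes> u"
  shows "x = y"
proof -
  have "x = (x \<otimes> u) \<otimes> inv u"
    using assms(1,2) by (simp add: m_assoc Units_closed)
  also have "\<dots> = y"
    unfolding assms(4) using assms(1,3) by (simp add: m_assoc Units_closed)
  finally show ?thesis .
qed

lemma Units_mult_left_cancel:
  assumes "a \<in> carrier R" "b \<in> Units R" "a \<otimes> b \<in> Units R"
  shows "a \<in> Units R"
proof -
  have "a = (a \<otimes> b) \<otimes> inv b"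
    using assms by (simp add: m_assoc Units_closed)
  moreover have "(a \<otimes> b) \<otimes> inv b \<in> Units R"
    using assms by blast
  ultimately show ?thesis by simp
qed

text \<open>The stable chain gives \<open>x u^n = y u u^n\<close> with \<open>y\<close> in
  \<open>J\<close>; the unit \<open>u^n\<close> cancels, so \<open>x = y u\<close>. This is how
  \<open>J u\<close> inside \<open>J\<close> improves to equality, which later makes extended ideals
  two-sided.\<close>

lemma left_artinian_left_ideal_inv_closed:
  assumes art: "left_artinian R" and J: "left_ideal J R" and u: "u \<in> Units R"
    and Ju: "\<And>x. x \<in> J \<Longrightarrow> x \<otimes> u \<in> J" and x: "x \<in> J"
  shows "x \<otimes> inv u \<in> J"
proof -
  note carr = left_ideal_closed(1)[OF J, THEN subsetD]
  obtain n :: nat and y where y: "y \<in> J" and eq: "x \<otimes> u [^] n = (y \<otimes> u) \<otimes> u [^] n"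
    using left_artinian_power_stable[OF art J Units_closed[OF u] Ju] x by blast
  have "u [^] n \<in> Units R"
    using u by (induction n) auto
  then have "x = y \<otimes> u"
    using Units_r_cancel eq carr x y Units_closed[OF u] by simp
  then have "x \<otimes> inv u = y"
    using carr[OF y] u by (simp add: m_assoc Units_closed)
  then show ?thesis
    using y by simp
qed

end

text \<open>A descending chain in \<open>S\<close> pulls back to one in \<open>R\<close>, and by
  surjectivity each \<open>J n\<close> is the image of its preimage \<open>K n\<close>, so both
  chains become stationary together.\<close>

lemma (in ring_hom_ring) left_artinian_image:
  assumes surj: "h ` carrier R = carrier S" and art: "left_artinian R"
  shows "left_artinian S"
  unfolding left_artinian_def
proof (intro allI impI)
  fix J :: "nat \<Rightarrow> 'c set"
  assume "(\<forall>n. left_ideal (J n) S) \<and> (\<forall>n. J (Suc n) \<subseteq> J n)"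
  then have J: "left_ideal (J n) S" and decr: "J (Suc n) \<subseteq> J n" for n
    by auto
  define K where "K n = {x \<in> carrier R. h x \<in> J n}" for n
  have "left_ideal (K n) R" for n
    unfolding K_def using S.left_ideal_closed[OF J[of n]]
    by (intro R.left_idealI) auto
  moreover have "K (Suc n) \<subseteq> K n" for n
    using decr by (auto simp: K_def)
  ultimately obtain N where N: "\<forall>n \<ge> N. K n = K N"
    using art unfolding left_artinian_def by blast
  have "J n = h ` K n" for n
  proof -
    have "J n \<subseteq> h ` carrier R"
      using S.left_ideal_closed(1)[OF J[of n]] surj by simp
    then show ?thesis
      unfolding K_def by auto
  qed
  then show "\<exists>N. \<forall>n \<ge> N. J n = J N"
    using N by metis
qed

subsection \<open>Cosets modulo an ideal\<close>

lemma (in ideal) coset_eq_zero_iff: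
  assumes "a \<in> carrier R"
  shows "I +> a = \<zero>\<^bsub>R Quot I\<^esub> \<longleftrightarrow> a \<in> I"
  using assms rcos_const_imp_mem a_rcos_const by (auto simp: FactRing_def)

lemma (in ideal) quotient_cases:
  assumes "X \<in> carrier (R Quot I)"
  obtains a where "a \<in> carrier R" "X = I +> a"
  using assms unfolding FactRing_def A_RCOSETS_def' by auto

lemma (in ideal) coset_closed: "a \<in> carrier R \<Longrightarrow> I +> a \<in> carrier (R Quot I)"
  unfolding FactRing_def A_RCOSETS_def' by auto

text \<open>This moves regularity modulo \<open>I\<close> down to representatives, so that later
  arguments can stay in \<open>R\<close>.\<close>

lemma (in ideal) regular_coset_iff:
  assumes c: "c \<in> carrier R"
  shows "I +> c \<in> regular_elements (R Quot I) \<longleftrightarrow>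
    (\<forall>r \<in> carrier R. (c \<otimes> r \<in> I \<longrightarrow> r \<in> I) \<and> (r \<otimes> c \<in> I \<longrightarrow> r \<in> I))"
proof -
  interpret \<pi>: ring_hom_ring R "R Quot I" "(+>) I"
    by (rule rcos_ring_hom_ring)
  have carr: "carrier (R Quot I) = (+>) I ` carrier R"
    using coset_closed quotient_cases by blast
  have l: "(I +> c) \<otimes>\<^bsub>R Quot I\<^esub> (I +> r) = \<zero>\<^bsub>R Quot I\<^esub> \<longleftrightarrow> c \<otimes> r \<in> I"
    and r: "(I +> r) \<otimes>\<^bsub>R Quot I\<^esub> (I +> c) = \<zero>\<^bsub>R Quot I\<^esub> \<longleftrightarrow> r \<otimes> c \<in> I"
    if "r \<in> carrier R" for r
    using that c coset_eq_zero_iff \<pi>.hom_mult[symmetric] by (simp_all del: \<pi>.hom_mult)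
  show ?thesis
    unfolding regular_elements_def carr
    using c by (auto simp: l r coset_eq_zero_iff)
qed

lemma (in ideal) left_artinian_quotient:
  assumes "left_artinian R"
  shows "left_artinian (R Quot I)"
proof -
  interpret \<pi>: ring_hom_ring R "R Quot I" "(+>) I"
    by (rule rcos_ring_hom_ring)
  have "(+>) I ` carrier R = carrier (R Quot I)"
    using coset_closed quotient_cases by blast
  then show ?thesis
    using assms by (rule \<pi>.left_artinian_image)
qed

subsection \<open>The prime radical\<close>

context ring
begin

text \<open>Zorn's lemma applies to the left ideals that contain \<open>J\<close> and avoid
  \<open>\<one>\<close>: a union of a nonempty chain of them still avoids \<open>\<one>\<close>, and
  it is closed under sums because any two members are comparable.\<close>

lemma exists_maximal_left_ideal:
  assumes J: "left_ideal J R" and one: "\<one> \<notin> J"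
  obtains M where "left_ideal M R" "J \<subseteq> M" "\<one> \<notin> M"
    and "\<And>K. left_ideal K R \<Longrightarrow> M \<subseteq> K \<Longrightarrow> \<one> \<notin> K \<Longrightarrow> K = M"
proof -
  define A where "A = {K. left_ideal K R \<and> J \<subseteq> K \<and> \<one> \<notin> K}"
  have "\<exists>M \<in> A. \<forall>K \<in> A. M \<subseteq> K \<longrightarrow> K = M"
  proof (rule subset_Zorn_nonempty)
    show "A \<noteq> {}"
      using J one by (auto simp: A_def)
  next
    fix X assume ne: "X \<noteq> {}" and chain: "subset.chain A X"
    have K: "left_ideal K R" "J \<subseteq> K" "\<one> \<notin> K" if "K \<in> X" for K
      using chain that by (auto simp: A_def subset_chain_def)
    have "left_ideal (\<Union> X) R"
    proof (rule left_idealI)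
      show "\<Union> X \<subseteq> carrier R"
        using left_ideal_closed(1)[OF K(1)] by blast
      show "\<zero> \<in> \<Union> X"
        using left_ideal_closed(2)[OF K(1)] ne by blast
      show "a \<otimes> x \<in> \<Union> X" if "a \<in> carrier R" "x \<in> \<Union> X" for a x
        using left_ideal_closed(4)[OF K(1)] that by blast
      show "x \<oplus> y \<in> \<Union> X" if xy: "x \<in> \<Union> X" "y \<in> \<Union> X" for x y
      proof -
        obtain K1 K2 where "x \<in> K1" "K1 \<in> X" "y \<in> K2" "K2 \<in> X"
          using xy by blast
        then obtain K where "K \<in> X" "x \<in> K" "y \<in> K"
          using chain unfolding subset_chain_def by (metis subsetD)
        then show ?thesis
          using left_ideal_closed(3)[OF K(1)] by blast
      qed
    qed
    then show "\<Union> X \<in> A"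
      using K ne unfolding A_def by blast
  qed
  then obtain M where M: "M \<in> A" and "\<And>K. K \<in> A \<Longrightarrow> M \<subseteq> K \<Longrightarrow> K = M"
    by blast
  then have "K = M" if "left_ideal K R" "M \<subseteq> K" "\<one> \<notin> K" for K
    using that by (auto simp: A_def)
  with M that show ?thesis
    by (auto simp: A_def)
qed

lemma left_ideal_sum:
  assumes "left_ideal J R" "left_ideal K R"
  shows "left_ideal {x \<oplus> y | x y. x \<in> J \<and> y \<in> K} R"
proof (rule left_idealI)
  note J = left_ideal_closed[OF assms(1)] and K = left_ideal_closed[OF assms(2)]
  show "{x \<oplus> y | x y. x \<in> J \<and> y \<in> K} \<subseteq> carrier R"
    using J(1) K(1) by auto
  show "\<zero> \<in> {x \<oplus> y | x y. x \<in> J \<and> y \<in> K}"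
    using J(2) K(2) by force
  show "p \<oplus> q \<in> {x \<oplus> y | x y. x \<in> J \<and> y \<in> K}"
    if pq: "p \<in> {x \<oplus> y | x y. x \<in> J \<and> y \<in> K}" "q \<in> {x \<oplus> y | x y. x \<in> J \<and> y \<in> K}" for p q
  proof -
    obtain x y x' y' where *: "x \<in> J" "y \<in> K" "x' \<in> J" "y' \<in> K" "p = x \<oplus> y" "q = x' \<oplus> y'"
      using pq by blast
    then have "p \<oplus> q = (x \<oplus> x') \<oplus> (y \<oplus> y')"
      using J(1) K(1) by (auto simp: subset_iff a_ac)
    then show ?thesis
      using * J(3) K(3) by blast
  qed
  show "a \<otimes> p \<in> {x \<oplus> y | x y. x \<in> J \<and> y \<in> K}"
    if a: "a \<in> carrier R" and p: "p \<in> {x \<oplus> y | x y. x \<in> J \<and> y \<in> K}" for a p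
  proof -
    obtain x y where *: "x \<in> J" "y \<in> K" "p = x \<oplus> y"
      using p by blast
    then have "a \<otimes> p = a \<otimes> x \<oplus> a \<otimes> y"
      using J(1) K(1) a by (auto simp: subset_iff r_distr)
    then show ?thesis
      using * J(4) K(4) a by blast
  qed
qed

lemma ideal_imp_left_ideal: "ideal A R \<Longrightarrow> left_ideal A R"
  by (simp add: left_ideal_def ideal.axioms(1) ideal.I_l_closed)

text \<open>The ideal in question is the annihilator of the simple left module \<open>R/M\<close>.\<close>

lemma maximal_left_ideal_core_prime:
  assumes M: "left_ideal M R" "\<one> \<notin> M"
    and maximal: "\<And>K. left_ideal K R \<Longrightarrow> M \<subseteq> K \<Longrightarrow> \<one> \<notin> K \<Longrightarrow> K = M"
  shows "prime_ideal {x \<in> carrier R. \<forall>q \<in> carrier R. x \<otimes> q \<in> M} R" (is "prime_ideal ?P R")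
proof -
  note M' = left_ideal_closed[OF M(1)]
  have "left_ideal ?P R"
    using M' by (intro left_idealI) (auto simp: l_distr m_assoc)
  then have "ideal ?P R"
    by (intro ideal.intro ring_axioms ideal_axioms.intro)
      (auto simp: left_ideal_def m_assoc)
  moreover have "\<one> \<notin> ?P"
    using M(2) by auto
  then have "?P \<noteq> carrier R"
    by blast
  moreover have "A \<subseteq> ?P"
    if A: "ideal A R" and B: "ideal B R" and AB: "A \<cdot> B \<subseteq> ?P" and nB: "\<not> B \<subseteq> ?P" for A B
  proof
    fix a assume a: "a \<in> A"
    interpret A: ideal A R by fact
    interpret B: ideal B R by fact
    obtain b q where b: "b \<in> B" "q \<in> carrier R" "b \<otimes> q \<notin> M"
      using nB B.a_subset by blast
    \<comment> \<open>\<open>K\<close> is \<open>M + B\<close>. It contains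
      \<open>b \<otimes> q\<close>, which is outside \<open>M\<close>, so maximality of
      \<open>M\<close> forces \<open>\<one>\<close> into it.\<close>
    define K where "K = {x \<oplus> y | x y. x \<in> M \<and> y \<in> B}"
    have K: "left_ideal K R"
      unfolding K_def using M(1) ideal_imp_left_ideal[OF B] by (rule left_ideal_sum)
    have "M \<subseteq> K"
    proof
      fix x assume "x \<in> M"
      then have "x = x \<oplus> \<zero>"
        using M'(1) by auto
      then show "x \<in> K"
        unfolding K_def using \<open>x \<in> M\<close> B.zero_closed by blast
    qed
    moreover have "b \<otimes> q \<in> K"
    proof -
      have "b \<otimes> q = \<zero> \<oplus> b \<otimes> q"
        using b B.a_subset by auto
      then show ?thesis
        unfolding K_def using M'(2) B.I_r_closed b by blast
    qed
    ultimately have "\<one> \<in> K"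
      using maximal[OF K] b(3) by blast
    then obtain m b' where m: "m \<in> M" and b': "b' \<in> B" and one: "\<one> = m \<oplus> b'"
      unfolding K_def by blast
    \<comment> \<open>Multiplying \<open>\<one> = m \<oplus> b'\<close> by
      \<open>a \<otimes> r\<close> on the left splits \<open>a \<otimes> r\<close> into a part in
      \<open>M\<close>, a left ideal, and a part in the product of \<open>A\<close> and
      \<open>B\<close>, which lies in the annihilator and hence, evaluated at \<open>\<one>\<close>,
      in \<open>M\<close>.\<close>
    have "a \<otimes> r \<in> M" if r: "r \<in> carrier R" for r
    proof -
      have ar: "a \<otimes> r \<in> A"
        using a r by (rule A.I_r_closed)
      have carr: "a \<otimes> r \<in> carrier R" "m \<in> carrier R" "b' \<in> carrier R"
        using A.Icarr[OF ar] m M'(1) B.Icarr[OF b'] by auto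
      have "(a \<otimes> r) \<otimes> b' \<in> ?P"
        using AB ideal_prod.prod[OF ar b'] by blast
      then have "((a \<otimes> r) \<otimes> b') \<otimes> \<one> \<in> M"
        by blast
      then have "(a \<otimes> r) \<otimes> b' \<in> M"
        using carr by simp
      moreover have "(a \<otimes> r) \<otimes> m \<in> M"
        using M'(4) carr m by blast
      moreover have "a \<otimes> r = (a \<otimes> r) \<otimes> m \<oplus> (a \<otimes> r) \<otimes> b'"
        using carr one by (metis r_distr r_one)
      ultimately show ?thesis
        using M'(3) by metis
    qed
    then show "a \<in> ?P"
      using A.Icarr[OF a] by blast
  qed
  ultimately show ?thesis
    unfolding prime_ideal_def by blast
qed

text \<open>If the left ideal generated by \<open>1 - l\<close> were proper, it would lie in a
  maximal left ideal \<open>M\<close>. The annihilator of \<open>R/M\<close> is prime, so it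
  contains \<open>l\<close>, and evaluating at \<open>\<one>\<close> puts \<open>l\<close> into
  \<open>M\<close>; then \<open>1 = (1 - l) + l\<close> would be in \<open>M\<close> too.\<close>

lemma prime_radical_quasi_regular:
  assumes l: "l \<in> prime_radical R"
  obtains u where "u \<in> carrier R" "u \<otimes> (\<one> \<ominus> l) = \<one>"
proof (cases "\<one> \<in> (\<lambda>x. x \<otimes> (\<one> \<ominus> l)) ` carrier R")
  case True
  then show ?thesis
    using that by (metis (no_types, lifting) imageE)
next
  case False
  have lR: "l \<in> carrier R"
    using l by (simp add: prime_radical_def)
  have "left_ideal (carrier R) R"
    by (rule left_idealI) auto
  then have "left_ideal ((\<lambda>x. x \<otimes> (\<one> \<ominus> l)) ` carrier R) R"
    using lR by (simp add: left_ideal_mult_right)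
  then obtain M where M: "left_ideal M R" "\<one> \<notin> M"
    and sub: "(\<lambda>x. x \<otimes> (\<one> \<ominus> l)) ` carrier R \<subseteq> M"
    and maximal: "\<And>K. left_ideal K R \<Longrightarrow> M \<subseteq> K \<Longrightarrow> \<one> \<notin> K \<Longrightarrow> K = M"
    using exists_maximal_left_ideal[OF _ False] by metis
  have "l \<in> {x \<in> carrier R. \<forall>q \<in> carrier R. x \<otimes> q \<in> M}"
    using l maximal_left_ideal_core_prime[OF M maximal] by (auto simp: prime_radical_def)
  then have "l \<otimes> \<one> \<in> M"
    by blast
  moreover have "\<one> \<otimes> (\<one> \<ominus> l) \<in> M"
    using sub by blast
  ultimately have "\<one> \<otimes> (\<one> \<ominus> l) \<oplus> l \<otimes> \<one> \<in> M"
    using left_ideal_closed(3)[OF M(1)] by blast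
  moreover have "\<one> \<otimes> (\<one> \<ominus> l) \<oplus> l \<otimes> \<one> = \<one>"
    using lR by (simp add: a_minus_def a_assoc l_neg)
  ultimately show ?thesis
    using M(2) by simp
qed

end

subsection \<open>Left quotient rings\<close>

context ring_hom_ring
begin

lemma hom_Units:
  assumes "u \<in> Units R"
  shows "h u \<in> Units S" and "h (inv u) = inv\<^bsub>S\<^esub> h u"
proof -
  have l: "h (inv u) \<otimes>\<^bsub>S\<^esub> h u = \<one>\<^bsub>S\<^esub>" and r: "h u \<otimes>\<^bsub>S\<^esub> h (inv u) = \<one>\<^bsub>S\<^esub>"
    using assms hom_mult[of "inv u" u] hom_mult[of u "inv u"] by (auto simp: R.Units_closed)
  have carr: "h u \<in> carrier S" "h (inv u) \<in> carrier S"
    using assms by (auto simp: R.Units_closed)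
  with l r show "h u \<in> Units S"
    by (auto simp: Units_def)
  from l r carr show "h (inv u) = inv\<^bsub>S\<^esub> h u"
    by (metis S.inv_char)
qed

lemma hom_left_fraction:
  assumes "\<psi> c \<in> Units R" "\<psi> r \<in> carrier R"
  shows "h (left_fraction R \<psi> c r) = left_fraction S (\<lambda>x. h (\<psi> x)) c r"
  using assms hom_Units by (simp add: left_fraction_def)

end

lemma regular_elements_mult_closed:
  assumes "ring R" "c \<in> regular_elements R" "d \<in> regular_elements R"
  shows "c \<otimes>\<^bsub>R\<^esub> d \<in> regular_elements R"
proof -
  interpret ring R by fact
  have carr: "c \<in> carrier R" "d \<in> carrier R"
    and c: "\<And>r. r \<in> carrier R \<Longrightarrow> c \<otimes>\<^bsub>R\<^esub> r = \<zero>\<^bsub>R\<^esub> \<Longrightarrow> r = \<zero>\<^bsub>R\<^esub>"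
      "\<And>r. r \<in> carrier R \<Longrightarrow> r \<otimes>\<^bsub>R\<^esub> c = \<zero>\<^bsub>R\<^esub> \<Longrightarrow> r = \<zero>\<^bsub>R\<^esub>"
    and d: "\<And>r. r \<in> carrier R \<Longrightarrow> d \<otimes>\<^bsub>R\<^esub> r = \<zero>\<^bsub>R\<^esub> \<Longrightarrow> r = \<zero>\<^bsub>R\<^esub>"
      "\<And>r. r \<in> carrier R \<Longrightarrow> r \<otimes>\<^bsub>R\<^esub> d = \<zero>\<^bsub>R\<^esub> \<Longrightarrow> r = \<zero>\<^bsub>R\<^esub>"
    using assms(2,3) unfolding regular_elements_def by blast+
  have "r = \<zero>\<^bsub>R\<^esub>" if r: "r \<in> carrier R" "(c \<otimes>\<^bsub>R\<^esub> d) \<otimes>\<^bsub>R\<^esub> r = \<zero>\<^bsub>R\<^esub>" for r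
  proof -
    have "c \<otimes>\<^bsub>R\<^esub> (d \<otimes>\<^bsub>R\<^esub> r) = \<zero>\<^bsub>R\<^esub>"
      using r carr by (simp only: m_assoc)
    then have "d \<otimes>\<^bsub>R\<^esub> r = \<zero>\<^bsub>R\<^esub>"
      by (rule c(1)[rotated]) (simp add: r(1) carr)
    then show ?thesis
      by (rule d(1)[OF r(1)])
  qed
  moreover have "r = \<zero>\<^bsub>R\<^esub>" if r: "r \<in> carrier R" "r \<otimes>\<^bsub>R\<^esub> (c \<otimes>\<^bsub>R\<^esub> d) = \<zero>\<^bsub>R\<^esub>" for r
  proof -
    have "(r \<otimes>\<^bsub>R\<^esub> c) \<otimes>\<^bsub>R\<^esub> d = \<zero>\<^bsub>R\<^esub>"
      using r carr by (simp only: m_assoc)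
    then have "r \<otimes>\<^bsub>R\<^esub> c = \<zero>\<^bsub>R\<^esub>"
      by (rule d(2)[rotated]) (simp add: r(1) carr)
    then show ?thesis
      by (rule c(2)[OF r(1)])
  qed
  ultimately show ?thesis
    unfolding regular_elements_def using carr by blast
qed

section \<open>Arithmetic of left fractions\<close>

locale left_quotient = ring_hom_ring R Q \<phi>
  for R (structure) and Q (structure) and \<phi> +
  assumes left_quotient_ring: "left_quotient_ring R Q \<phi>"
begin

abbreviation regs :: "'a set" (\<open>\<C>\<close>)
  where "\<C> \<equiv> regular_elements R"

lemma regular_carrier: "c \<in> \<C> \<Longrightarrow> c \<in> carrier R"
  by (simp add: regular_elements_def)

lemma regular_mult: "c \<in> \<C> \<Longrightarrow> d \<in> \<C> \<Longrightarrow> c \<otimes> d \<in> \<C>"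
  using R.ring_axioms by (rule regular_elements_mult_closed)

lemma one_regular: "\<one> \<in> \<C>"
  by (auto simp: regular_elements_def)

lemma hom_inj: "r \<in> carrier R \<Longrightarrow> s \<in> carrier R \<Longrightarrow> \<phi> r = \<phi> s \<longleftrightarrow> r = s"
  using left_quotient_ring unfolding left_quotient_ring_def by (meson inj_on_eq_iff)

lemma hom_regular: "c \<in> \<C> \<Longrightarrow> \<phi> c \<in> Units Q"
  using left_quotient_ring unfolding left_quotient_ring_def by blast

text \<open>A zero product with \<open>c\<close> is carried to \<open>Q\<close>, where the unit
  \<open>\<phi> c\<close> cancels; injectivity of \<open>\<phi>\<close> brings the result back. This
  is how invertibility in \<open>Q\<close> yields regularity in \<open>R\<close>.\<close>

lemma regular_if_Units:
  assumes c: "c \<in> carrier R" and unit: "\<phi> c \<in> Units Q"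
  shows "c \<in> \<C>"
proof -
  have "r = \<zero>" if "r \<in> carrier R" "c \<otimes> r = \<zero>" for r
  proof -
    have "\<phi> c \<otimes>\<^bsub>Q\<^esub> \<phi> r = \<phi> (c \<otimes> r)"
      using that(1) c by simp
    also have "\<dots> = \<phi> c \<otimes>\<^bsub>Q\<^esub> \<zero>\<^bsub>Q\<^esub>"
      unfolding that(2) using c by simp
    finally have "\<phi> c \<otimes>\<^bsub>Q\<^esub> \<phi> r = \<phi> c \<otimes>\<^bsub>Q\<^esub> \<zero>\<^bsub>Q\<^esub>" .
    then have "\<phi> r = \<phi> \<zero>"
      using S.Units_l_cancel[OF unit] that(1) by simp
    then show ?thesis
      using hom_inj[of r \<zero>] that(1) by simp
  qed
  moreover have "r = \<zero>" if "r \<in> carrier R" "r \<otimes> c = \<zero>" for r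
  proof -
    have "\<phi> r \<otimes>\<^bsub>Q\<^esub> \<phi> c = \<phi> (r \<otimes> c)"
      using that(1) c by simp
    also have "\<dots> = \<zero>\<^bsub>Q\<^esub> \<otimes>\<^bsub>Q\<^esub> \<phi> c"
      unfolding that(2) using c by simp
    finally have "\<phi> r \<otimes>\<^bsub>Q\<^esub> \<phi> c = \<zero>\<^bsub>Q\<^esub> \<otimes>\<^bsub>Q\<^esub> \<phi> c" .
    then have "\<phi> r = \<phi> \<zero>"
      using S.Units_r_cancel[OF unit] that(1) by simp
    then show ?thesis
      using hom_inj[of r \<zero>] that(1) by simp
  qed
  ultimately show ?thesis
    unfolding regular_elements_def using c by blast
qed

text \<open>Multiplying by the unit \<open>\<phi> c\<close> clears the denominator. Most later
  computations use this form without inverses.\<close>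

lemma eq_left_fraction_iff:
  assumes "c \<in> \<C>" "r \<in> carrier R" "q \<in> carrier Q"
  shows "q = left_fraction Q \<phi> c r \<longleftrightarrow> \<phi> c \<otimes>\<^bsub>Q\<^esub> q = \<phi> r"
proof -
  have u: "\<phi> c \<in> Units Q"
    using assms(1) by (rule hom_regular)
  have "\<phi> c \<otimes>\<^bsub>Q\<^esub> left_fraction Q \<phi> c r = \<phi> r"
    using u assms(2) by (simp add: left_fraction_def S.m_assoc[symmetric] S.Units_closed)
  moreover have "left_fraction Q \<phi> c r \<in> carrier Q"
    using u assms(2) by (simp add: left_fraction_def)
  ultimately show ?thesis
    using S.Units_l_cancel[OF u] assms(3) by metis
qed

lemma left_fraction_closed: "c \<in> \<C> \<Longrightarrow> r \<in> carrier R \<Longrightarrow> left_fraction Q \<phi> c r \<in> carrier Q"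
  by (simp add: left_fraction_def hom_regular)

lemma left_fraction_cases:
  assumes "q \<in> carrier Q"
  obtains c r where "c \<in> \<C>" "r \<in> carrier R" "q = left_fraction Q \<phi> c r"
  using assms left_quotient_ring unfolding left_quotient_ring_def left_fractions_def by blast

lemma denominator:
  assumes "q \<in> carrier Q"
  obtains c r where "c \<in> \<C>" "r \<in> carrier R" "\<phi> c \<otimes>\<^bsub>Q\<^esub> q = \<phi> r"
  using assms by (metis left_fraction_cases eq_left_fraction_iff)

text \<open>The left Ore condition, in the form \<open>q c\<inverse> = e\<inverse> w\<close>.\<close>

lemma ore:
  assumes q: "q \<in> carrier Q" and c: "c \<in> \<C>"
  obtains e w where "e \<in> \<C>" "w \<in> carrier R" "\<phi> e \<otimes>\<^bsub>Q\<^esub> q = \<phi> w \<otimes>\<^bsub>Q\<^esub> \<phi> c"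
proof -
  have u: "\<phi> c \<in> Units Q"
    using c by (rule hom_regular)
  then have qc: "q \<otimes>\<^bsub>Q\<^esub> inv\<^bsub>Q\<^esub> \<phi> c \<in> carrier Q"
    using q by simp
  then obtain e w where ew: "e \<in> \<C>" "w \<in> carrier R" "\<phi> e \<otimes>\<^bsub>Q\<^esub> (q \<otimes>\<^bsub>Q\<^esub> inv\<^bsub>Q\<^esub> \<phi> c) = \<phi> w"
    by (rule denominator)
  have "\<phi> e \<otimes>\<^bsub>Q\<^esub> q = (\<phi> e \<otimes>\<^bsub>Q\<^esub> (q \<otimes>\<^bsub>Q\<^esub> inv\<^bsub>Q\<^esub> \<phi> c)) \<otimes>\<^bsub>Q\<^esub> \<phi> c"
    using u q ew(1) by (simp add: S.m_assoc S.Units_closed hom_regular regular_carrier)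
  then show ?thesis
    using that ew by simp
qed

text \<open>The Ore condition for \<open>\<phi> c\<close> and \<open>d\<close> is pulled back along
  the injective map \<open>\<phi>\<close>. The common multiple is regular as the product
  \<open>u \<otimes> c\<close>; about \<open>v\<close> only membership in \<open>R\<close> is
  claimed.\<close>

lemma regular_common_multiple:
  assumes c: "c \<in> \<C>" and d: "d \<in> \<C>"
  obtains u v where "u \<in> \<C>" "v \<in> carrier R" "u \<otimes> c = v \<otimes> d" "u \<otimes> c \<in> \<C>"
proof -
  obtain u v where uv: "u \<in> \<C>" "v \<in> carrier R" "\<phi> u \<otimes>\<^bsub>Q\<^esub> \<phi> c = \<phi> v \<otimes>\<^bsub>Q\<^esub> \<phi> d"
    using ore[OF _ d, of "\<phi> c"] c by (auto simp: regular_carrier)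
  then have "\<phi> (u \<otimes> c) = \<phi> (v \<otimes> d)"
    using c d by (simp add: regular_carrier)
  then have "u \<otimes> c = v \<otimes> d"
    using hom_inj[of "u \<otimes> c" "v \<otimes> d"] uv(1,2) c d by (simp add: regular_carrier del: hom_mult)
  then show ?thesis
    using that uv regular_mult c by blast
qed

lemma common_denominator:
  assumes x: "x \<in> carrier Q" and y: "y \<in> carrier Q"
  obtains c r s where "c \<in> \<C>" "r \<in> carrier R" "s \<in> carrier R"
    and "\<phi> c \<otimes>\<^bsub>Q\<^esub> x = \<phi> r" "\<phi> c \<otimes>\<^bsub>Q\<^esub> y = \<phi> s"
proof -
  obtain c r where c: "c \<in> \<C>" "r \<in> carrier R" "\<phi> c \<otimes>\<^bsub>Q\<^esub> x = \<phi> r"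
    using x by (rule denominator)
  obtain d s where d: "d \<in> \<C>" "s \<in> carrier R" "\<phi> d \<otimes>\<^bsub>Q\<^esub> y = \<phi> s"
    using y by (rule denominator)
  obtain u v where uv: "u \<in> \<C>" "v \<in> carrier R" "u \<otimes> c = v \<otimes> d" "u \<otimes> c \<in> \<C>"
    using c(1) d(1) by (rule regular_common_multiple)
  note carr = uv(1)[THEN regular_carrier] c(1)[THEN regular_carrier] d(1)[THEN regular_carrier]
  have "\<phi> (u \<otimes> c) \<otimes>\<^bsub>Q\<^esub> x = \<phi> (u \<otimes> r)"
    using carr c x by (simp add: S.m_assoc)
  moreover have "\<phi> (u \<otimes> c) \<otimes>\<^bsub>Q\<^esub> y = \<phi> (v \<otimes> s)"
    unfolding uv(3) using carr d y uv(2) by (simp add: S.m_assoc)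
  ultimately show ?thesis
    using carr c(2) d(2) uv(2) by (intro that[OF uv(4), of "u \<otimes> r" "v \<otimes> s"] R.m_closed)
qed

section \<open>Extending homomorphisms to fractions\<close>

lemma numerator_independent:
  assumes T: "ring T" and g: "g \<in> ring_hom R T" and units: "g ` \<C> \<subseteq> Units T"
    and q: "q \<in> carrier Q" and t: "t \<in> carrier T"
    and c: "c \<in> \<C>" "r \<in> carrier R" "\<phi> c \<otimes>\<^bsub>Q\<^esub> q = \<phi> r" "g c \<otimes>\<^bsub>T\<^esub> t = g r"
    and d: "d \<in> \<C>" "s \<in> carrier R" "\<phi> d \<otimes>\<^bsub>Q\<^esub> q = \<phi> s"
  shows "g d \<otimes>\<^bsub>T\<^esub> t = g s"
proof -
  interpret g: ring_hom_ring R T g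
    using R.ring_axioms T g by (rule ring_hom_ringI2)
  obtain u v where uv: "u \<in> \<C>" "v \<in> carrier R" "u \<otimes> c = v \<otimes> d" "u \<otimes> c \<in> \<C>"
    using c(1) d(1) by (rule regular_common_multiple)
  note carr = uv(1)[THEN regular_carrier] c(1)[THEN regular_carrier] d(1)[THEN regular_carrier]
  \<comment> \<open>Over the common denominator \<open>u \<otimes> c = v \<otimes> d\<close> the two
    numerators of \<open>q\<close> coincide, already in \<open>R\<close> by injectivity of
    \<open>\<phi>\<close>. Applying \<open>g\<close> to this equality compares the two conditions on
    \<open>t\<close>.\<close>
  have "\<phi> (u \<otimes> r) = \<phi> (u \<otimes> c) \<otimes>\<^bsub>Q\<^esub> q"
    using carr c q by (simp add: S.m_assoc)
  also have "\<dots> = \<phi> (v \<otimes> s)"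
    unfolding uv(3) using carr d q uv(2) by (simp add: S.m_assoc)
  finally have ur: "u \<otimes> r = v \<otimes> s"
    using hom_inj[of "u \<otimes> r" "v \<otimes> s"] carr uv(2) c(2) d(2) by (simp del: hom_mult)
  \<comment> \<open>Since \<open>v\<close> is not known to be regular, \<open>g v\<close> is seen to
    be a unit indirectly: its product with the unit \<open>g d\<close> is the image of the regular
    element \<open>u \<otimes> c\<close>.\<close>
  have "g v \<otimes>\<^bsub>T\<^esub> g d \<in> Units T"
    using units uv carr d(1) by (metis g.hom_mult image_subset_iff)
  then have v: "g v \<in> Units T"
    using g.S.Units_mult_left_cancel[of "g v" "g d"] units d(1) uv(2) by auto
  have "g v \<otimes>\<^bsub>T\<^esub> (g d \<otimes>\<^bsub>T\<^esub> t) = g (u \<otimes> c) \<otimes>\<^bsub>T\<^esub> t"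
    unfolding uv(3) using carr uv(2) t by (simp add: g.S.m_assoc)
  also have "\<dots> = g (v \<otimes> s)"
    unfolding ur[symmetric] using carr c t by (simp add: g.S.m_assoc)
  also have "\<dots> = g v \<otimes>\<^bsub>T\<^esub> g s"
    using uv(2) d(2) by simp
  finally show ?thesis
    using g.S.Units_l_cancel[OF v] t carr d(2) by simp
qed

text \<open>The value at \<open>q\<close> is a \<open>t\<close> that solves
  \<open>g c t = g r\<close> for every representation of \<open>q\<close> at once, by
  \<open>numerator_independent\<close>. The homomorphism laws are checked after clearing
  denominators and cancelling a unit of \<open>T\<close>.\<close>

lemma universal_property:
  assumes T: "ring T" and g: "g \<in> ring_hom R T" and units: "g ` \<C> \<subseteq> Units T"
  obtains f where "f \<in> ring_hom Q T"
    and "\<And>c r. c \<in> \<C> \<Longrightarrow> r \<in> carrier R \<Longrightarrow> f (left_fraction Q \<phi> c r) = left_fraction T g c r"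
proof -
  interpret g: ring_hom_ring R T g
    using R.ring_axioms T g by (rule ring_hom_ringI2)
  have gc: "g c \<in> Units T" if "c \<in> \<C>" for c
    using units that by blast
  have "\<exists>t \<in> carrier T. \<forall>c \<in> \<C>. \<forall>r \<in> carrier R. \<phi> c \<otimes>\<^bsub>Q\<^esub> q = \<phi> r \<longrightarrow> g c \<otimes>\<^bsub>T\<^esub> t = g r"
    if q: "q \<in> carrier Q" for q
  proof -
    obtain c r where c: "c \<in> \<C>" "r \<in> carrier R" "\<phi> c \<otimes>\<^bsub>Q\<^esub> q = \<phi> r"
      using q by (rule denominator)
    define t where "t = inv\<^bsub>T\<^esub> g c \<otimes>\<^bsub>T\<^esub> g r"
    have t: "t \<in> carrier T" "g c \<otimes>\<^bsub>T\<^esub> t = g r"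
      using gc[OF c(1)] c(2) by (simp_all add: t_def g.S.m_assoc[symmetric] g.S.Units_closed)
    then show ?thesis
      using numerator_independent[OF T g units q t(1) c t(2)] by blast
  qed
  then obtain f where f: "\<And>q. q \<in> carrier Q \<Longrightarrow> f q \<in> carrier T"
    and fq: "\<And>q c r. q \<in> carrier Q \<Longrightarrow> c \<in> \<C> \<Longrightarrow> r \<in> carrier R \<Longrightarrow> \<phi> c \<otimes>\<^bsub>Q\<^esub> q = \<phi> r
      \<Longrightarrow> g c \<otimes>\<^bsub>T\<^esub> f q = g r"
    by metis
  have "f \<in> ring_hom Q T"
  proof (rule ring_hom_memI)
    show "f x \<in> carrier T" if "x \<in> carrier Q" for x
      using that by (rule f)
    show "f (x \<oplus>\<^bsub>Q\<^esub> y) = f x \<oplus>\<^bsub>T\<^esub> f y" if xy: "x \<in> carrier Q" "y \<in> carrier Q" for x y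
    proof -
      obtain c r s where c: "c \<in> \<C>" "r \<in> carrier R" "s \<in> carrier R"
        and r: "\<phi> c \<otimes>\<^bsub>Q\<^esub> x = \<phi> r" and s: "\<phi> c \<otimes>\<^bsub>Q\<^esub> y = \<phi> s"
        using xy by (rule common_denominator)
      note cR = c(1)[THEN regular_carrier]
      have "\<phi> c \<otimes>\<^bsub>Q\<^esub> (x \<oplus>\<^bsub>Q\<^esub> y) = \<phi> (r \<oplus> s)"
        using c cR r s xy by (simp add: S.r_distr)
      from fq[OF _ c(1) _ this] have "g c \<otimes>\<^bsub>T\<^esub> f (x \<oplus>\<^bsub>Q\<^esub> y) = g (r \<oplus> s)"
        using c xy by simp
      also have "\<dots> = g c \<otimes>\<^bsub>T\<^esub> (f x \<oplus>\<^bsub>T\<^esub> f y)"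
        using fq[OF xy(1) c(1,2) r] fq[OF xy(2) c(1,3) s] c cR f xy by (simp add: g.S.r_distr)
      finally show ?thesis
        using g.S.Units_l_cancel[OF gc[OF c(1)]] f xy by simp
    qed
    show "f (x \<otimes>\<^bsub>Q\<^esub> y) = f x \<otimes>\<^bsub>T\<^esub> f y" if xy: "x \<in> carrier Q" "y \<in> carrier Q" for x y
    proof -
      obtain d s where d: "d \<in> \<C>" "s \<in> carrier R" "\<phi> d \<otimes>\<^bsub>Q\<^esub> y = \<phi> s"
        using xy(2) by (rule denominator)
      \<comment> \<open>The Ore condition moves the denominator \<open>d\<close> of \<open>y\<close>
        past \<open>x\<close>: from \<open>e x = w d\<close> follows \<open>e (x y) = w s\<close>,
        an explicit numerator for the product.\<close>
      obtain e w where e: "e \<in> \<C>" "w \<in> carrier R" "\<phi> e \<otimes>\<^bsub>Q\<^esub> x = \<phi> w \<otimes>\<^bsub>Q\<^esub> \<phi> d"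
        using xy(1) d(1) by (rule ore)
      note carr = d(1)[THEN regular_carrier] e(1)[THEN regular_carrier]
      have ex: "\<phi> e \<otimes>\<^bsub>Q\<^esub> x = \<phi> (w \<otimes> d)"
        using e carr by simp
      have gex: "g e \<otimes>\<^bsub>T\<^esub> f x = g w \<otimes>\<^bsub>T\<^esub> g d"
        using fq[OF xy(1) e(1) _ ex] e carr by simp
      have "\<phi> e \<otimes>\<^bsub>Q\<^esub> (x \<otimes>\<^bsub>Q\<^esub> y) = (\<phi> e \<otimes>\<^bsub>Q\<^esub> x) \<otimes>\<^bsub>Q\<^esub> y"
        using xy carr by (simp add: S.m_assoc)
      also have "\<dots> = \<phi> w \<otimes>\<^bsub>Q\<^esub> (\<phi> d \<otimes>\<^bsub>Q\<^esub> y)"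
        unfolding e(3) using xy carr e(2) by (simp add: S.m_assoc)
      also have "\<dots> = \<phi> (w \<otimes> s)"
        using e d by simp
      finally have "\<phi> e \<otimes>\<^bsub>Q\<^esub> (x \<otimes>\<^bsub>Q\<^esub> y) = \<phi> (w \<otimes> s)" .
      from fq[OF _ e(1) _ this] have "g e \<otimes>\<^bsub>T\<^esub> f (x \<otimes>\<^bsub>Q\<^esub> y) = g (w \<otimes> s)"
        using e d xy by simp
      also have "\<dots> = g w \<otimes>\<^bsub>T\<^esub> (g d \<otimes>\<^bsub>T\<^esub> f y)"
        using fq[OF xy(2) d] e d by simp
      also have "\<dots> = (g e \<otimes>\<^bsub>T\<^esub> f x) \<otimes>\<^bsub>T\<^esub> f y"
        unfolding gex using e carr f xy by (simp add: g.S.m_assoc)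
      also have "\<dots> = g e \<otimes>\<^bsub>T\<^esub> (f x \<otimes>\<^bsub>T\<^esub> f y)"
        using carr f xy by (simp add: g.S.m_assoc)
      finally show ?thesis
        using g.S.Units_l_cancel[OF gc[OF e(1)]] f xy by simp
    qed
    show "f \<one>\<^bsub>Q\<^esub> = \<one>\<^bsub>T\<^esub>"
      using fq[OF S.one_closed one_regular R.one_closed] f by simp
  qed
  moreover have "f (left_fraction Q \<phi> c r) = left_fraction T g c r"
    if c: "c \<in> \<C>" and r: "r \<in> carrier R" for c r
  proof -
    let ?q = "left_fraction Q \<phi> c r"
    have q: "?q \<in> carrier Q"
      using c r by (rule left_fraction_closed)
    then have "g c \<otimes>\<^bsub>T\<^esub> f ?q = g r"
      using fq c r eq_left_fraction_iff by blast
    then have "inv\<^bsub>T\<^esub> g c \<otimes>\<^bsub>T\<^esub> (g c \<otimes>\<^bsub>T\<^esub> f ?q) = left_fraction T g c r"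
      by (simp add: left_fraction_def)
    then show ?thesis
      using gc[OF c] f[OF q] by (simp add: g.S.m_assoc[symmetric] g.S.Units_closed)
  qed
  ultimately show ?thesis
    using that by blast
qed

subsection \<open>Extension and contraction of ideals\<close>

lemma left_fractions_iff:
  assumes "A \<subseteq> carrier R"
  shows "q \<in> left_fractions Q \<phi> \<C> A \<longleftrightarrow>
    q \<in> carrier Q \<and> (\<exists>c \<in> \<C>. \<exists>a \<in> A. \<phi> c \<otimes>\<^bsub>Q\<^esub> q = \<phi> a)"
proof -
  have "q = left_fraction Q \<phi> c a \<longleftrightarrow> q \<in> carrier Q \<and> \<phi> c \<otimes>\<^bsub>Q\<^esub> q = \<phi> a"
    if "c \<in> \<C>" "a \<in> A" for c a
    using that assms eq_left_fraction_iff left_fraction_closed by blast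
  then show ?thesis
    unfolding left_fractions_def by blast
qed

text \<open>Sums are handled with a common multiple of the denominators and products with the Ore
  condition. In both cases numerators are only multiplied from the left, so they stay in
  \<open>A\<close>.\<close>

lemma left_ideal_left_fractions:
  assumes A: "left_ideal A R"
  shows "left_ideal (left_fractions Q \<phi> \<C> A) Q"
proof (rule S.left_idealI)
  note A' = R.left_ideal_closed[OF A]
  note iff = left_fractions_iff[OF A'(1)]
  show "left_fractions Q \<phi> \<C> A \<subseteq> carrier Q"
    using iff by blast
  have "\<phi> \<one> \<otimes>\<^bsub>Q\<^esub> \<zero>\<^bsub>Q\<^esub> = \<phi> \<zero>"
    by simp
  then show "\<zero>\<^bsub>Q\<^esub> \<in> left_fractions Q \<phi> \<C> A"
    using iff A'(2) one_regular S.zero_closed by blast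
  show "x \<oplus>\<^bsub>Q\<^esub> y \<in> left_fractions Q \<phi> \<C> A"
    if xy: "x \<in> left_fractions Q \<phi> \<C> A" "y \<in> left_fractions Q \<phi> \<C> A" for x y
  proof -
    obtain c a where x: "x \<in> carrier Q" and c: "c \<in> \<C>" "a \<in> A" "\<phi> c \<otimes>\<^bsub>Q\<^esub> x = \<phi> a"
      using xy(1) iff by blast
    obtain d b where y: "y \<in> carrier Q" and d: "d \<in> \<C>" "b \<in> A" "\<phi> d \<otimes>\<^bsub>Q\<^esub> y = \<phi> b"
      using xy(2) iff by blast
    \<comment> \<open>The common multiple is spelled out, as \<open>common_denominator\<close> would
      forget that the numerators lie in \<open>A\<close>.\<close>
    obtain u v where uv: "u \<in> \<C>" "v \<in> carrier R" "u \<otimes> c = v \<otimes> d" "u \<otimes> c \<in> \<C>"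
      using c(1) d(1) by (rule regular_common_multiple)
    note carr = uv(1)[THEN regular_carrier] c(1)[THEN regular_carrier] d(1)[THEN regular_carrier]
    have ab: "a \<in> carrier R" "b \<in> carrier R"
      using c(2) d(2) A'(1) by auto
    have "\<phi> (u \<otimes> c) \<otimes>\<^bsub>Q\<^esub> x = \<phi> (u \<otimes> a)"
      using carr c x ab by (simp add: S.m_assoc)
    moreover have "\<phi> (u \<otimes> c) \<otimes>\<^bsub>Q\<^esub> y = \<phi> (v \<otimes> b)"
      unfolding uv(3) using carr d y uv(2) ab by (simp add: S.m_assoc)
    moreover have "\<phi> (u \<otimes> c) \<otimes>\<^bsub>Q\<^esub> (x \<oplus>\<^bsub>Q\<^esub> y) = \<phi> (u \<otimes> c) \<otimes>\<^bsub>Q\<^esub> x \<oplus>\<^bsub>Q\<^esub> \<phi> (u \<otimes> c) \<otimes>\<^bsub>Q\<^esub> y"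
      using x y carr by (intro S.r_distr) auto
    ultimately have "\<phi> (u \<otimes> c) \<otimes>\<^bsub>Q\<^esub> (x \<oplus>\<^bsub>Q\<^esub> y) = \<phi> (u \<otimes> a \<oplus> v \<otimes> b)"
      using ab carr uv(2) by simp
    moreover have "u \<otimes> a \<oplus> v \<otimes> b \<in> A"
      using A' c(2) d(2) carr uv(2) by blast
    ultimately show ?thesis
      using iff uv(4) x y S.a_closed by blast
  qed
  show "x \<otimes>\<^bsub>Q\<^esub> q \<in> left_fractions Q \<phi> \<C> A"
    if x: "x \<in> carrier Q" and q: "q \<in> left_fractions Q \<phi> \<C> A" for x q
  proof -
    obtain c a where qQ: "q \<in> carrier Q" and c: "c \<in> \<C>" "a \<in> A" "\<phi> c \<otimes>\<^bsub>Q\<^esub> q = \<phi> a"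
      using q iff by blast
    obtain e w where e: "e \<in> \<C>" "w \<in> carrier R" "\<phi> e \<otimes>\<^bsub>Q\<^esub> x = \<phi> w \<otimes>\<^bsub>Q\<^esub> \<phi> c"
      using x c(1) by (rule ore)
    note carr = c(1)[THEN regular_carrier] e(1)[THEN regular_carrier]
    have "\<phi> e \<otimes>\<^bsub>Q\<^esub> (x \<otimes>\<^bsub>Q\<^esub> q) = (\<phi> e \<otimes>\<^bsub>Q\<^esub> x) \<otimes>\<^bsub>Q\<^esub> q"
      using x qQ carr by (simp add: S.m_assoc)
    also have "\<dots> = \<phi> w \<otimes>\<^bsub>Q\<^esub> (\<phi> c \<otimes>\<^bsub>Q\<^esub> q)"
      unfolding e(3) using qQ carr e(2) by (simp add: S.m_assoc)
    also have "\<dots> = \<phi> (w \<otimes> a)"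
      using e c A'(1) by auto
    finally show ?thesis
      using iff e A'(4) c(2) x qQ S.m_closed by blast
  qed
qed

text \<open>Right multiplication by \<open>\<phi> r\<close> acts on numerators, where
  \<open>A\<close> absorbs \<open>r\<close>. Right multiplication by the inverse of
  \<open>\<phi> c\<close> is the delicate part: it stays inside the extension because the chain of
  left ideals obtained by multiplying with powers of \<open>\<phi> c\<close> stabilises in
  \<open>Q\<close>.\<close>

lemma ideal_left_fractions:
  assumes art: "left_artinian Q" and A: "ideal A R"
  shows "ideal (left_fractions Q \<phi> \<C> A) Q" (is "ideal ?L Q")
proof -
  interpret A: ideal A R by fact
  note iff = left_fractions_iff[OF A.a_subset]
  have L: "left_ideal ?L Q"
    using R.ideal_imp_left_ideal[OF A] by (rule left_ideal_left_fractions)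
  have right: "q \<otimes>\<^bsub>Q\<^esub> \<phi> r \<in> ?L" if q: "q \<in> ?L" and r: "r \<in> carrier R" for q r
  proof -
    obtain c a where qQ: "q \<in> carrier Q" and c: "c \<in> \<C>" "a \<in> A" "\<phi> c \<otimes>\<^bsub>Q\<^esub> q = \<phi> a"
      using q iff by blast
    have "\<phi> c \<otimes>\<^bsub>Q\<^esub> (q \<otimes>\<^bsub>Q\<^esub> \<phi> r) = (\<phi> c \<otimes>\<^bsub>Q\<^esub> q) \<otimes>\<^bsub>Q\<^esub> \<phi> r"
      using qQ r regular_carrier[OF c(1)] by (simp add: S.m_assoc)
    also have "\<dots> = \<phi> (a \<otimes> r)"
      using c r A.Icarr by simp
    finally show ?thesis
      using iff c A.I_r_closed r qQ by (meson S.m_closed hom_closed)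
  qed
  have "q \<otimes>\<^bsub>Q\<^esub> x \<in> ?L" if q: "q \<in> ?L" and x: "x \<in> carrier Q" for q x
  proof -
    obtain c r where c: "c \<in> \<C>" "r \<in> carrier R" "x = left_fraction Q \<phi> c r"
      using x by (rule left_fraction_cases)
    have u: "\<phi> c \<in> Units Q"
      using c(1) by (rule hom_regular)
    have "q \<otimes>\<^bsub>Q\<^esub> inv\<^bsub>Q\<^esub> \<phi> c \<in> ?L"
      using S.left_artinian_left_ideal_inv_closed[OF art L u] right regular_carrier[OF c(1)] q
      by blast
    then have "(q \<otimes>\<^bsub>Q\<^esub> inv\<^bsub>Q\<^esub> \<phi> c) \<otimes>\<^bsub>Q\<^esub> \<phi> r \<in> ?L"
      using c(2) by (rule right)
    moreover have "q \<in> carrier Q"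
      using q iff by blast
    ultimately show ?thesis
      unfolding c(3) left_fraction_def using u c(2) by (simp add: S.m_assoc)
  qed
  then show ?thesis
    using L by (auto intro!: ideal.intro ideal_axioms.intro S.ring_axioms simp: left_ideal_def)
qed

section \<open>Contraction to the base ring\<close>

lemma left_fractions_contraction:
  assumes A: "A \<subseteq> carrier R" and closed: "C_closed R A" and r: "r \<in> carrier R"
    and "\<phi> r \<in> left_fractions Q \<phi> \<C> A"
  shows "r \<in> A"
proof -
  obtain c a where c: "c \<in> \<C>" "a \<in> A" "\<phi> c \<otimes>\<^bsub>Q\<^esub> \<phi> r = \<phi> a"
    using assms(4) left_fractions_iff[OF A] by blast
  then have "\<phi> (c \<otimes> r) = \<phi> a"
    using r by (simp add: regular_carrier)
  then have "c \<otimes> r = a"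
    using hom_inj[of "c \<otimes> r" a] c(1,2) r A by (auto simp: regular_carrier simp del: hom_mult)
  \<comment> \<open>The factor \<open>c\<close> in \<open>c \<otimes> r = a\<close> is removed by
    \<open>closed\<close>.\<close>
  then show ?thesis
    using closed c r by (auto simp: C_closed_def)
qed

lemma hom_in_left_fractions:
  assumes "A \<subseteq> carrier R" "a \<in> A"
  shows "\<phi> a \<in> left_fractions Q \<phi> \<C> A"
proof -
  have "\<phi> \<one> \<otimes>\<^bsub>Q\<^esub> \<phi> a = \<phi> a" "\<phi> a \<in> carrier Q"
    using assms by auto
  then show ?thesis
    using left_fractions_iff[OF assms(1)] one_regular assms(2) by blast
qed

text \<open>Two ideals of \<open>R\<close> whose product lies in the contraction are extended to
  \<open>Q\<close>, where the Artinian condition makes the extensions two-sided. Their product lies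
  in \<open>M\<close>, so primeness of \<open>M\<close> captures one extension, and with it the
  original ideal.\<close>

lemma prime_ideal_contraction:
  assumes art: "left_artinian Q" and M: "prime_ideal M Q"
  shows "prime_ideal {r \<in> carrier R. \<phi> r \<in> M} R" (is "prime_ideal ?P R")
proof -
  interpret M: ideal M Q
    using M by (simp add: prime_ideal_def)
  have "left_ideal ?P R"
    using S.left_ideal_closed[OF S.ideal_imp_left_ideal[OF M.is_ideal]]
    by (intro R.left_idealI) auto
  then have "ideal ?P R"
    by (intro ideal.intro R.ring_axioms ideal_axioms.intro)
      (auto simp: left_ideal_def M.I_r_closed)
  moreover have "\<one> \<notin> ?P"
    using M M.one_imp_carrier by (auto simp: prime_ideal_def)
  then have "?P \<noteq> carrier R"
    by blast
  moreover have "A \<subseteq> ?P \<or> B \<subseteq> ?P" if A: "ideal A R" and B: "ideal B R" and AB: "A \<cdot> B \<subseteq> ?P" for A B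
  proof -
    interpret A: ideal A R by fact
    interpret B: ideal B R by fact
    let ?A = "left_fractions Q \<phi> \<C> A" and ?B = "left_fractions Q \<phi> \<C> B"
    interpret QA: ideal ?A Q
      using art A by (rule ideal_left_fractions)
    have mult: "x \<otimes>\<^bsub>Q\<^esub> y \<in> M" if x: "x \<in> ?A" and y: "y \<in> ?B" for x y
    proof -
      obtain d b where d: "d \<in> \<C>" "b \<in> B" "\<phi> d \<otimes>\<^bsub>Q\<^esub> y = \<phi> b" and yQ: "y \<in> carrier Q"
        using y left_fractions_iff[OF B.a_subset] by blast
      have u: "\<phi> d \<in> Units Q"
        using d(1) by (rule hom_regular)
      have xQ: "x \<in> carrier Q"
        using x by (rule QA.Icarr)
      \<comment> \<open>The extension of \<open>A\<close> absorbs the inverse of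
        \<open>\<phi> d\<close> on the right. Inserting \<open>d\<inverse> d\<close> between
        \<open>x\<close> and \<open>y\<close> then gives
        \<open>c x y = (c x d\<inverse>) (d y) = a b\<close>, an element of the product of
        \<open>A\<close> and \<open>B\<close>.\<close>
      have "x \<otimes>\<^bsub>Q\<^esub> inv\<^bsub>Q\<^esub> \<phi> d \<in> ?A"
        using x u by (simp add: QA.I_r_closed)
      then obtain c a where c: "c \<in> \<C>" "a \<in> A" "\<phi> c \<otimes>\<^bsub>Q\<^esub> (x \<otimes>\<^bsub>Q\<^esub> inv\<^bsub>Q\<^esub> \<phi> d) = \<phi> a"
        using left_fractions_iff[OF A.a_subset] by blast
      have v: "\<phi> c \<in> Units Q"
        using c(1) by (rule hom_regular)
      have "\<phi> c \<otimes>\<^bsub>Q\<^esub> (x \<otimes>\<^bsub>Q\<^esub> y) = \<phi> c \<otimes>\<^bsub>Q\<^esub> (x \<otimes>\<^bsub>Q\<^esub> ((inv\<^bsub>Q\<^esub> \<phi> d \<otimes>\<^bsub>Q\<^esub> \<phi> d) \<otimes>\<^bsub>Q\<^esub> y))"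
        using u yQ by simp
      also have "\<dots> = (\<phi> c \<otimes>\<^bsub>Q\<^esub> (x \<otimes>\<^bsub>Q\<^esub> inv\<^bsub>Q\<^esub> \<phi> d)) \<otimes>\<^bsub>Q\<^esub> (\<phi> d \<otimes>\<^bsub>Q\<^esub> y)"
        using u v xQ yQ by (simp add: S.m_assoc S.Units_closed del: S.Units_l_inv)
      also have "\<dots> = \<phi> (a \<otimes> b)"
        unfolding c(3) d(3) using c(2) d(2) A.Icarr B.Icarr by simp
      finally have "\<phi> c \<otimes>\<^bsub>Q\<^esub> (x \<otimes>\<^bsub>Q\<^esub> y) \<in> M"
        using AB ideal_prod.prod[OF c(2) d(2), of R] by auto
      then have "inv\<^bsub>Q\<^esub> \<phi> c \<otimes>\<^bsub>Q\<^esub> (\<phi> c \<otimes>\<^bsub>Q\<^esub> (x \<otimes>\<^bsub>Q\<^esub> y)) \<in> M"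
        using v by (simp add: M.I_l_closed)
      then show ?thesis
        using v xQ yQ by (simp add: S.m_assoc[symmetric] S.Units_closed)
    qed
    have "ideal_prod Q ?A ?B \<subseteq> M"
    proof
      fix z assume "z \<in> ideal_prod Q ?A ?B"
      then show "z \<in> M"
        by induction (auto simp: mult M.a_closed)
    qed
    then have "?A \<subseteq> M \<or> ?B \<subseteq> M"
      using M QA.is_ideal ideal_left_fractions[OF art B] by (simp add: prime_ideal_def)
    then show ?thesis
      using hom_in_left_fractions A.a_subset B.a_subset by blast
  qed
  ultimately show ?thesis
    unfolding prime_ideal_def by blast
qed

text \<open>Every prime \<open>M\<close> of \<open>Q\<close> contracts to a prime of
  \<open>R\<close>, which contains \<open>A\<close>; so \<open>M\<close> contains
  \<open>\<phi> a\<close>, and with it each fraction with numerator \<open>a\<close>.\<close>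

lemma left_fractions_prime_radical:
  assumes art: "left_artinian Q" and A: "A \<subseteq> prime_radical R"
  shows "left_fractions Q \<phi> \<C> A \<subseteq> prime_radical Q"
proof
  fix q assume q: "q \<in> left_fractions Q \<phi> \<C> A"
  have "A \<subseteq> carrier R"
    using A by (auto simp: prime_radical_def)
  then obtain c a where qQ: "q \<in> carrier Q" and c: "c \<in> \<C>" "a \<in> A" "\<phi> c \<otimes>\<^bsub>Q\<^esub> q = \<phi> a"
    using q left_fractions_iff by blast
  have u: "\<phi> c \<in> Units Q"
    using c(1) by (rule hom_regular)
  have "q \<in> M" if M: "prime_ideal M Q" for M
  proof -
    interpret M: ideal M Q
      using M by (simp add: prime_ideal_def)
    have "\<phi> a \<in> M"
      using A c(2) prime_ideal_contraction[OF art M] by (auto simp: prime_radical_def)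
    then have "inv\<^bsub>Q\<^esub> \<phi> c \<otimes>\<^bsub>Q\<^esub> (\<phi> c \<otimes>\<^bsub>Q\<^esub> q) \<in> M"
      using u c(3) by (simp add: M.I_l_closed)
    then show ?thesis
      using u qQ by (simp add: S.m_assoc[symmetric] S.Units_closed)
  qed
  then show "q \<in> prime_radical Q"
    using qQ by (auto simp: prime_radical_def)
qed

end

subsection \<open>Closed ideals in the prime radical\<close>

locale closed_radical_ideal = left_quotient R Q \<phi> + I: ideal I R
  for R (structure) and Q (structure) and \<phi> and I +
  assumes left_artinian: "left_artinian Q"
    and C_closed: "C_closed R I"
    and in_prime_radical: "I \<subseteq> prime_radical R"
begin

abbreviation L :: "'c set"
  where "L \<equiv> left_fractions Q \<phi> \<C> I"

sublocale L: ideal L Q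
  using left_artinian I.is_ideal by (rule ideal_left_fractions)

sublocale \<pi>: ring_hom_ring Q "Q Quot L" "(+>\<^bsub>Q\<^esub>) L"
  by (rule L.rcos_ring_hom_ring)

sublocale \<rho>: ring_hom_ring R "R Quot I" "(+>) I"
  by (rule I.rcos_ring_hom_ring)

text \<open>The extension \<open>L\<close> contracts back to \<open>I\<close> because
  \<open>I\<close> is closed; this is what makes \<open>R/I\<close> embed in
  \<open>Q/L\<close>.\<close>

lemma hom_in_extension_iff: "r \<in> carrier R \<Longrightarrow> \<phi> r \<in> L \<longleftrightarrow> r \<in> I"
  using left_fractions_contraction[OF I.a_subset C_closed] hom_in_left_fractions[OF I.a_subset]
  by blast

text \<open>Membership in \<open>L\<close> provides only some representation with numerator in
  \<open>I\<close>. Clearing the given denominator and contracting shows that every numerator of the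
  fraction is in \<open>I\<close>.\<close>

lemma left_fraction_in_extension_iff:
  assumes c: "c \<in> \<C>" and r: "r \<in> carrier R"
  shows "left_fraction Q \<phi> c r \<in> L \<longleftrightarrow> r \<in> I"
proof
  assume "left_fraction Q \<phi> c r \<in> L"
  then have "\<phi> c \<otimes>\<^bsub>Q\<^esub> left_fraction Q \<phi> c r \<in> L"
    using c by (simp add: L.I_l_closed regular_carrier)
  moreover have "\<phi> c \<otimes>\<^bsub>Q\<^esub> left_fraction Q \<phi> c r = \<phi> r"
    using eq_left_fraction_iff[OF c r left_fraction_closed[OF c r]] by blast
  ultimately show "r \<in> I"
    using hom_in_extension_iff r by simp
next
  assume "r \<in> I"
  then show "left_fraction Q \<phi> c r \<in> L"
    unfolding left_fractions_def using c by blast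
qed

text \<open>Comparing numerators turns cancellation modulo \<open>I\<close> into cancellation of the
  coset of \<open>\<phi> c\<close> in \<open>Q/L\<close>, which is left Artinian, so that coset is a
  unit. Its inverse lifts to some \<open>y\<close> with \<open>1 - y c\<close> in \<open>L\<close>,
  hence in the prime radical of \<open>Q\<close>; so \<open>y c\<close> is left invertible, and
  \<open>\<phi> c\<close> is left invertible in the left Artinian ring \<open>Q\<close>.\<close>

lemma coset_right_cancel_imp_Units:
  assumes c: "c \<in> carrier R" and cancel: "\<And>r. r \<in> carrier R \<Longrightarrow> r \<otimes> c \<in> I \<Longrightarrow> r \<in> I"
  shows "\<phi> c \<in> Units Q"
proof -
  let ?c = "L +>\<^bsub>Q\<^esub> \<phi> c"
  have "X = \<zero>\<^bsub>Q Quot L\<^esub>" if X: "X \<in> carrier (Q Quot L)" "X \<otimes>\<^bsub>Q Quot L\<^esub> ?c = \<zero>\<^bsub>Q Quot L\<^esub>" for X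
  proof -
    obtain q where q: "q \<in> carrier Q" "X = L +>\<^bsub>Q\<^esub> q"
      using X(1) by (rule L.quotient_cases)
    obtain d r where d: "d \<in> \<C>" "r \<in> carrier R" "q = left_fraction Q \<phi> d r"
      using q(1) by (rule left_fraction_cases)
    have "L +>\<^bsub>Q\<^esub> (q \<otimes>\<^bsub>Q\<^esub> \<phi> c) = \<zero>\<^bsub>Q Quot L\<^esub>"
      using X(2) q c by simp
    then have "q \<otimes>\<^bsub>Q\<^esub> \<phi> c \<in> L"
      using L.coset_eq_zero_iff[of "q \<otimes>\<^bsub>Q\<^esub> \<phi> c"] q(1) c by simp
    moreover have "q \<otimes>\<^bsub>Q\<^esub> \<phi> c = left_fraction Q \<phi> d (r \<otimes> c)"
      using d c hom_regular[OF d(1)] by (simp add: left_fraction_def S.m_assoc)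
    ultimately have "r \<otimes> c \<in> I"
      using left_fraction_in_extension_iff[OF d(1)] d(2) c by simp
    then have "q \<in> L"
      using cancel left_fraction_in_extension_iff[OF d(1,2)] d by simp
    then show ?thesis
      using L.coset_eq_zero_iff q by simp
  qed
  then have unit: "?c \<in> Units (Q Quot L)"
    using \<pi>.S.left_artinian_right_cancel_Units L.left_artinian_quotient[OF left_artinian]
      L.coset_closed c hom_closed by blast
  then obtain y where y: "y \<in> carrier Q" "inv\<^bsub>Q Quot L\<^esub> ?c = L +>\<^bsub>Q\<^esub> y"
    using \<pi>.S.Units_inv_closed L.quotient_cases by metis
  have "(L +>\<^bsub>Q\<^esub> y) \<otimes>\<^bsub>Q Quot L\<^esub> ?c = \<one>\<^bsub>Q Quot L\<^esub>"
    using \<pi>.S.Units_l_inv[OF unit] y(2) by simp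
  then have "L +>\<^bsub>Q\<^esub> \<one>\<^bsub>Q\<^esub> = L +>\<^bsub>Q\<^esub> (y \<otimes>\<^bsub>Q\<^esub> \<phi> c)"
    using y(1) c by simp
  then have "\<one>\<^bsub>Q\<^esub> \<ominus>\<^bsub>Q\<^esub> y \<otimes>\<^bsub>Q\<^esub> \<phi> c \<in> L"
    using S.quotient_eq_iff_same_a_r_cos[OF L.is_ideal] y(1) c by simp
  then have "\<one>\<^bsub>Q\<^esub> \<ominus>\<^bsub>Q\<^esub> y \<otimes>\<^bsub>Q\<^esub> \<phi> c \<in> prime_radical Q"
    using left_fractions_prime_radical[OF left_artinian in_prime_radical] by blast
  then obtain u where u: "u \<in> carrier Q"
    "u \<otimes>\<^bsub>Q\<^esub> (\<one>\<^bsub>Q\<^esub> \<ominus>\<^bsub>Q\<^esub> (\<one>\<^bsub>Q\<^esub> \<ominus>\<^bsub>Q\<^esub> y \<otimes>\<^bsub>Q\<^esub> \<phi> c)) = \<one>\<^bsub>Q\<^esub>"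
    by (rule S.prime_radical_quasi_regular)
  \<comment> \<open>Quasi-regularity was used for the radical element \<open>l = 1 - y c\<close>, so
    the left invertible element \<open>1 - l\<close> is \<open>y c\<close>.\<close>
  have "\<one>\<^bsub>Q\<^esub> \<ominus>\<^bsub>Q\<^esub> (\<one>\<^bsub>Q\<^esub> \<ominus>\<^bsub>Q\<^esub> y \<otimes>\<^bsub>Q\<^esub> \<phi> c) = y \<otimes>\<^bsub>Q\<^esub> \<phi> c"
    using y(1) c by (simp add: a_minus_def S.minus_add S.r_neg2)
  then have "(u \<otimes>\<^bsub>Q\<^esub> y) \<otimes>\<^bsub>Q\<^esub> \<phi> c = \<one>\<^bsub>Q\<^esub>"
    using u y(1) c by (simp add: S.m_assoc)
  then show ?thesis
    by (rule S.left_artinian_left_inverse_Units[OF left_artinian S.m_closed[OF u(1) y(1)] hom_closed[OF c]])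
qed

text \<open>A regular coset makes \<open>\<phi> c\<close> a unit, so \<open>c\<close> is regular.
  Conversely, left cancellation modulo \<open>I\<close> is \<open>C_closed\<close>, while right
  cancellation uses that \<open>L\<close> is two-sided: the inverse of \<open>\<phi> c\<close> may
  be multiplied on the right without leaving \<open>L\<close>.\<close>

lemma regular_coset_iff:
  assumes c: "c \<in> carrier R"
  shows "I +> c \<in> regular_elements (R Quot I) \<longleftrightarrow> c \<in> \<C>"
proof
  assume "I +> c \<in> regular_elements (R Quot I)"
  then show "c \<in> \<C>"
    using I.regular_coset_iff[OF c] coset_right_cancel_imp_Units[OF c] regular_if_Units[OF c]
    by blast
next
  assume C: "c \<in> \<C>"
  have "r \<in> I" if r: "r \<in> carrier R" "r \<otimes> c \<in> I" for r
  proof -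
    have "\<phi> (r \<otimes> c) \<in> L"
      using hom_in_extension_iff r c by blast
    then have "(\<phi> r \<otimes>\<^bsub>Q\<^esub> \<phi> c) \<otimes>\<^bsub>Q\<^esub> inv\<^bsub>Q\<^esub> \<phi> c \<in> L"
      using r(1) c hom_regular[OF C] by (simp add: L.I_r_closed)
    then have "\<phi> r \<in> L"
      using r(1) c hom_regular[OF C] by (simp add: S.m_assoc)
    then show ?thesis
      using hom_in_extension_iff r(1) by blast
  qed
  then show "I +> c \<in> regular_elements (R Quot I)"
    unfolding I.regular_coset_iff[OF c] using C_closed C unfolding C_closed_def by blast
qed

lemma regular_elements_quotient: "regular_elements (R Quot I) = {I +> c | c. c \<in> \<C>}"
proof
  show "regular_elements (R Quot I) \<subseteq> {I +> c | c. c \<in> \<C>}"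
  proof
    fix X assume X: "X \<in> regular_elements (R Quot I)"
    then have "X \<in> carrier (R Quot I)"
      by (simp add: regular_elements_def)
    then obtain c where "c \<in> carrier R" "X = I +> c"
      by (rule I.quotient_cases)
    with X show "X \<in> {I +> c | c. c \<in> \<C>}"
      using regular_coset_iff by blast
  qed
  show "{I +> c | c. c \<in> \<C>} \<subseteq> regular_elements (R Quot I)"
    using regular_coset_iff regular_carrier by blast
qed

section \<open>The left quotient ring of the factor ring\<close>

lemma left_quotient_ring_quotient:
  obtains \<sigma> where "left_quotient_ring (R Quot I) (Q Quot L) \<sigma>"
proof -
  \<comment> \<open>The structure map of \<open>Q/L\<close> over \<open>R/I\<close> is induced by
    \<open>h\<close>, whose kernel is \<open>I\<close> because \<open>L\<close> contracts to
    \<open>I\<close>.\<close>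
  define h where "h = (\<lambda>r. L +>\<^bsub>Q\<^esub> \<phi> r)"
  interpret h: ring_hom_ring R "Q Quot L" h
    by (rule ring_hom_ringI) (simp_all add: h_def R.ring_axioms \<pi>.S.ring_axioms)
  have h0: "h r = \<zero>\<^bsub>Q Quot L\<^esub> \<longleftrightarrow> r \<in> I" if "r \<in> carrier R" for r
    using that L.coset_eq_zero_iff hom_in_extension_iff by (simp add: h_def)
  then have ker: "a_kernel R (Q Quot L) h = I"
    unfolding a_kernel_def' using I.a_subset by blast
  define \<sigma> where "\<sigma> = (\<lambda>X. the_elem (h ` X))"
  have \<sigma>: "\<sigma> (I +> r) = h r" if "r \<in> carrier R" for r
    using h.the_elem_simp[OF that] by (simp add: \<sigma>_def ker)
  have hom: "\<sigma> \<in> ring_hom (R Quot I) (Q Quot L)"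
    using h.the_elem_hom by (simp add: \<sigma>_def ker)
  have inj: "inj_on \<sigma> (carrier (R Quot I))"
    using h.the_elem_inj by (auto simp: \<sigma>_def ker intro!: inj_onI)
  have units: "\<sigma> (I +> c) \<in> Units (Q Quot L)" if "c \<in> \<C>" for c
    using that \<pi>.hom_Units(1) hom_regular regular_carrier by (simp add: \<sigma> h_def)
  have frac: "left_fraction (Q Quot L) \<sigma> (I +> c) (I +> r) = L +>\<^bsub>Q\<^esub> left_fraction Q \<phi> c r"
    if "c \<in> \<C>" "r \<in> carrier R" for c r
    using \<pi>.hom_left_fraction[of \<phi> c r] that hom_regular regular_carrier
    by (simp add: left_fraction_def \<sigma> h_def)
  have "X \<in> left_fractions (Q Quot L) \<sigma> (regular_elements (R Quot I)) (carrier (R Quot I))"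
    if X: "X \<in> carrier (Q Quot L)" for X
  proof -
    obtain q where q: "q \<in> carrier Q" "X = L +>\<^bsub>Q\<^esub> q"
      using X by (rule L.quotient_cases)
    obtain c r where c: "c \<in> \<C>" "r \<in> carrier R" "q = left_fraction Q \<phi> c r"
      using q(1) by (rule left_fraction_cases)
    have "X = left_fraction (Q Quot L) \<sigma> (I +> c) (I +> r)"
      using q c frac by simp
    then show ?thesis
      unfolding left_fractions_def regular_elements_quotient using c I.coset_closed by blast
  qed
  moreover have "left_fractions (Q Quot L) \<sigma> (regular_elements (R Quot I)) (carrier (R Quot I))
    \<subseteq> carrier (Q Quot L)"
  proof
    fix X assume "X \<in> left_fractions (Q Quot L) \<sigma> (regular_elements (R Quot I)) (carrier (R Quot I))"
    then obtain c Y where c: "c \<in> \<C>" "Y \<in> carrier (R Quot I)"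
      "X = left_fraction (Q Quot L) \<sigma> (I +> c) Y"
      unfolding left_fractions_def regular_elements_quotient by blast
    obtain r where "r \<in> carrier R" "Y = I +> r"
      using c(2) by (rule I.quotient_cases)
    then show "X \<in> carrier (Q Quot L)"
      using c frac L.coset_closed left_fraction_closed by simp
  qed
  moreover have "\<sigma> ` regular_elements (R Quot I) \<subseteq> Units (Q Quot L)"
    unfolding regular_elements_quotient using units by blast
  ultimately show ?thesis
    using that hom inj \<pi>.S.ring_axioms unfolding left_quotient_ring_def by blast
qed

text \<open>The map \<open>g\<close> sends \<open>\<C>\<close> to units, since regular elements stay
  regular modulo \<open>I\<close>, and so extends to \<open>f\<close> on \<open>Q\<close>. The
  extension is onto because regular elements of \<open>R/I\<close> lift to \<open>\<C>\<close>, and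
  its kernel is \<open>L\<close>; the first isomorphism theorem gives the claim, and the Artinian
  property passes to the image.\<close>

lemma left_quotient_ring_unique:
  assumes Q': "left_quotient_ring (R Quot I) Q' \<psi>"
  obtains f where "left_artinian Q'" "f \<in> ring_iso (Q Quot L) Q'"
    and "\<And>c r. c \<in> \<C> \<Longrightarrow> r \<in> carrier R \<Longrightarrow>
      f (L +>\<^bsub>Q\<^esub> left_fraction Q \<phi> c r) = left_fraction Q' \<psi> (I +> c) (I +> r)"
proof -
  interpret Q': left_quotient "R Quot I" Q' \<psi>
    using Q' \<rho>.S.ring_axioms unfolding left_quotient_ring_def
    by (intro left_quotient.intro ring_hom_ringI2 left_quotient_axioms.intro Q') auto
  define g where "g = (\<lambda>r. \<psi> (I +> r))"
  have g: "g \<in> ring_hom R Q'"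
    by (rule ring_hom_memI) (simp_all add: g_def)
  have "g ` \<C> \<subseteq> Units Q'"
    using Q'.hom_regular regular_coset_iff regular_carrier by (auto simp: g_def)
  then obtain f where f: "f \<in> ring_hom Q Q'"
    and frac: "\<And>c r. c \<in> \<C> \<Longrightarrow> r \<in> carrier R \<Longrightarrow> f (left_fraction Q \<phi> c r) = left_fraction Q' g c r"
    using universal_property[OF Q'.S.ring_axioms g] by blast
  have fg: "left_fraction Q' g c r = left_fraction Q' \<psi> (I +> c) (I +> r)" for c r
    by (simp add: left_fraction_def g_def)
  interpret f: ring_hom_ring Q Q' f
    using S.ring_axioms Q'.S.ring_axioms f by (rule ring_hom_ringI2)
  have surj: "f ` carrier Q = carrier Q'"
  proof
    show "f ` carrier Q \<subseteq> carrier Q'"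
      by auto
    show "carrier Q' \<subseteq> f ` carrier Q"
    proof
      fix q assume "q \<in> carrier Q'"
      then obtain X Y where X: "X \<in> regular_elements (R Quot I)" "Y \<in> carrier (R Quot I)"
        and q: "q = left_fraction Q' \<psi> X Y"
        by (rule Q'.left_fraction_cases)
      obtain c where c: "c \<in> \<C>" "X = I +> c"
        using X(1) unfolding regular_elements_quotient by blast
      obtain r where r: "r \<in> carrier R" "Y = I +> r"
        using X(2) by (rule I.quotient_cases)
      have "q = f (left_fraction Q \<phi> c r)"
        using q c r frac fg by simp
      then show "q \<in> f ` carrier Q"
        using left_fraction_closed[OF c(1) r(1)] by blast
    qed
  qed
  have zero: "f q = \<zero>\<^bsub>Q'\<^esub> \<longleftrightarrow> q \<in> L" if q: "q \<in> carrier Q" for q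
  proof -
    obtain c r where c: "c \<in> \<C>" "r \<in> carrier R" "q = left_fraction Q \<phi> c r"
      using q by (rule left_fraction_cases)
    have cr: "I +> c \<in> regular_elements (R Quot I)" "I +> r \<in> carrier (R Quot I)"
      using c regular_coset_iff regular_carrier I.coset_closed by auto
    \<comment> \<open>Vanishing of a fraction is tested by clearing its denominator, which leaves
      the numerator; injectivity of \<open>\<psi>\<close> then reduces the question to whether
      \<open>r\<close> is in \<open>I\<close>.\<close>
    have "f q = \<zero>\<^bsub>Q'\<^esub> \<longleftrightarrow> \<zero>\<^bsub>Q'\<^esub> = left_fraction Q' \<psi> (I +> c) (I +> r)"
      using c frac fg by auto
    also have "\<dots> \<longleftrightarrow> \<psi> (I +> c) \<otimes>\<^bsub>Q'\<^esub> \<zero>\<^bsub>Q'\<^esub> = \<psi> (I +> r)"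
      using cr Q'.S.zero_closed by (rule Q'.eq_left_fraction_iff)
    also have "\<dots> \<longleftrightarrow> \<psi> (I +> r) = \<psi> \<zero>\<^bsub>R Quot I\<^esub>"
      using cr Q'.regular_carrier by auto
    also have "\<dots> \<longleftrightarrow> I +> r = \<zero>\<^bsub>R Quot I\<^esub>"
      using cr(2) \<rho>.S.zero_closed by (rule Q'.hom_inj)
    also have "\<dots> \<longleftrightarrow> q \<in> L"
      using I.coset_eq_zero_iff left_fraction_in_extension_iff c by simp
    finally show ?thesis .
  qed
  then have ker: "a_kernel Q Q' f = L"
    unfolding a_kernel_def' using L.a_subset by blast
  have "(\<lambda>X. the_elem (f ` X)) \<in> ring_iso (Q Quot L) Q'"
    using f.FactRing_iso_set[OF surj] by (simp add: ker)
  moreover have "the_elem (f ` (L +>\<^bsub>Q\<^esub> left_fraction Q \<phi> c r)) = left_fraction Q' \<psi> (I +> c) (I +> r)"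
    if "c \<in> \<C>" "r \<in> carrier R" for c r
    using f.the_elem_simp[OF left_fraction_closed[OF that]] frac[OF that] fg by (simp add: ker)
  moreover have "left_artinian Q'"
    using surj left_artinian by (rule f.left_artinian_image)
  ultimately show ?thesis
    using that by blast
qed

end

text \<open>Existence is a separate conjunct, and the isomorphism is then given for an arbitrary
  left quotient ring of \<open>R/I\<close>, on any type, rather than for one chosen model.
  Prescribing \<open>f\<close> on all fractions determines it on the whole factor ring, so
  well-definedness of the formula is part of the claim.\<close>

theorem theorem5p1:
  fixes R :: "('a, 'm) ring_scheme"
    and Q :: "('q, 'n) ring_scheme" and \<phi> :: "'a \<Rightarrow> 'q"
    and Q' :: "('p, 'k) ring_scheme" and \<psi> :: "'a set \<Rightarrow> 'p"
    and I :: "'a set" and C :: "'a set" and CI :: "'q set"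
  assumes "ring R"
    and "left_quotient_ring R Q \<phi>" and "left_artinian Q"
    and "ideal I R" and "C_closed R I" and "I \<subseteq> prime_radical R"
  defines "C \<equiv> regular_elements R"
    and "CI \<equiv> left_fractions Q \<phi> C I"
  shows "regular_elements (R Quot I) = {I +>\<^bsub>R\<^esub> c | c. c \<in> C} \<and>
    (\<exists>(S :: 'q set ring) \<sigma>. left_quotient_ring (R Quot I) S \<sigma> \<and> left_artinian S) \<and>
    ideal CI Q \<and>
    (left_quotient_ring (R Quot I) Q' \<psi> \<longrightarrow>
      left_artinian Q' \<and>
      (\<exists>f \<in> ring_iso (Q Quot CI) Q'.
         \<forall>c \<in> C. \<forall>r \<in> carrier R.
           f (CI +>\<^bsub>Q\<^esub> left_fraction Q \<phi> c r)
             = left_fraction Q' \<psi> (I +>\<^bsub>R\<^esub> c) (I +>\<^bsub>R\<^esub> r) \<and>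
           inv_into (carrier (Q Quot CI)) f (left_fraction Q' \<psi> (I +>\<^bsub>R\<^esub> c) (I +>\<^bsub>R\<^esub> r))
             = CI +>\<^bsub>Q\<^esub> left_fraction Q \<phi> c r))"
proof -
  interpret closed_radical_ideal R Q \<phi> I
    using assms(1-6)
    by (intro closed_radical_ideal.intro left_quotient.intro left_quotient_axioms.intro
        ring_hom_ringI2 closed_radical_ideal_axioms.intro) (simp_all add: left_quotient_ring_def)
  have L: "CI = L"
    by (simp add: CI_def C_def)
  \<comment> \<open>The witness is \<open>Q Quot L\<close>, whose elements are cosets in
    \<open>Q\<close>.\<close>
  have "\<exists>(S :: 'q set ring) \<sigma>. left_quotient_ring (R Quot I) S \<sigma> \<and> left_artinian S"
    using left_quotient_ring_quotient L.left_artinian_quotient[OF left_artinian] by metis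
  moreover have "left_artinian Q' \<and>
      (\<exists>f \<in> ring_iso (Q Quot CI) Q'.
         \<forall>c \<in> C. \<forall>r \<in> carrier R.
           f (CI +>\<^bsub>Q\<^esub> left_fraction Q \<phi> c r)
             = left_fraction Q' \<psi> (I +>\<^bsub>R\<^esub> c) (I +>\<^bsub>R\<^esub> r) \<and>
           inv_into (carrier (Q Quot CI)) f (left_fraction Q' \<psi> (I +>\<^bsub>R\<^esub> c) (I +>\<^bsub>R\<^esub> r))
             = CI +>\<^bsub>Q\<^esub> left_fraction Q \<phi> c r)"
    if Q': "left_quotient_ring (R Quot I) Q' \<psi>"
  proof -
    obtain f where art: "left_artinian Q'" and iso: "f \<in> ring_iso (Q Quot L) Q'"
      and f: "\<And>c r. c \<in> \<C> \<Longrightarrow> r \<in> carrier R \<Longrightarrow>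
        f (L +>\<^bsub>Q\<^esub> left_fraction Q \<phi> c r) = left_fraction Q' \<psi> (I +>\<^bsub>R\<^esub> c) (I +>\<^bsub>R\<^esub> r)"
      using left_quotient_ring_unique[OF Q'] by blast
    have inj: "inj_on f (carrier (Q Quot L))"
      using iso by (simp add: ring_iso_def bij_betw_def)
    have "inv_into (carrier (Q Quot L)) f (left_fraction Q' \<psi> (I +>\<^bsub>R\<^esub> c) (I +>\<^bsub>R\<^esub> r))
        = L +>\<^bsub>Q\<^esub> left_fraction Q \<phi> c r"
      if c: "c \<in> \<C>" and r: "r \<in> carrier R" for c r
      \<comment> \<open>The fraction in \<open>Q'\<close> is rewritten as a value of
        \<open>f\<close>, so injectivity on the carrier makes \<open>inv_into\<close> undo
        it.\<close>
      unfolding f[OF c r, symmetric]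
      using inj L.coset_closed[OF left_fraction_closed[OF c r]] by (rule inv_into_f_f)
    with art iso f show ?thesis
      unfolding L C_def by blast
  qed
  ultimately show ?thesis
    using regular_elements_quotient L.is_ideal unfolding L C_def by blast
qed

end
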